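(* Let $\mathfrak{S}$ be a faithful cartesian club. Then the functor $L:\mathsf{O}_\mathfrak{S}\to\mathsf{T}_\mathfrak{S}$ is left adjoint to the functor $R:\mathsf{T}_\mathfrak{S}\to\mathsf{O}_\mathfrak{S}$. Moreover, the unit of this adjunction is an isomorphism.
   Context: Clubs. $\mathbf{Fun}$ is the category with objects the natural numbers and morphisms $n\to m$ the functions $\underline{n}\to\underline{m}$, where $\underline{n}=\{1,\ldots,n\}$. For $\mathbf{a}:n\to m$, $\mathbf{b}:h\to k$, $\mathbf{a}+\mathbf{b}:n+h\to m+k$ is $x\mapsto\mathbf{a}(x)$ for $x\le n$ and $x\mapsto\mathbf{b}(x-n)+m$ for $x>n$. For $\mathbf{a}:m\to n$ and $k_1,\ldots,k_n\in\mathbb{N}$, the wreath product $\mathbf{a}\wr(k_1,\ldots,k_n):\sum_{j=1}^m k_{\mathbf{a}(j)}\to\sum_{i=1}^n k_i$ sends the $p$-th element of the $j$-th block (of size $k_{\mathbf{a}(j)}$) to the $p$-th element of the $\mathbf{a}(j)$-th block. A faithful cartesian club is a subcategory $\mathfrak{S}$ of $\mathbf{Fun}$ containing all objects and closed under $+$ and under $\mathbf{a}\mapsto\mathbf{a}\wr(k_1,\ldots,k_n)$ for all $k_i$. Multicategories. A multicategory $\mathcal{M}$ has objects $\mathcal{M}_0$, morphism sets $\mathcal{M}(A_1,\ldots,A_n;B)$ ($n\ge 0$), identities $1_A\in\mathcal{M}(A;A)$, and associative unital composition sending $f\in\mathcal{M}(A_1,\ldots,A_n;B)$, $g_i\in\mathcal{M}(\Gamma_i;A_i)$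 to $f\circ(g_1,\ldots,g_n)\in\mathcal{M}(\Gamma_1,\ldots,\Gamma_n;B)$. $A^n$ (resp. $f^n$) means $n$ copies of $A$ (resp. $f$). An $\mathfrak{S}$-multicategory is a multicategory with operations $[-]\mathbf{a}:\mathcal{M}(A_{\mathbf{a}(1)},\ldots,A_{\mathbf{a}(m)};B)\to\mathcal{M}(A_1,\ldots,A_n;B)$ for each $\mathbf{a}:m\to n$ in $\mathfrak{S}$, such that $[[f]\mathbf{a}]\mathbf{b}=[f](\mathbf{b}\circ\mathbf{a})$; $[f]1=f$; $g\circ([f_1]\mathbf{a}_1,\ldots,[f_n]\mathbf{a}_n)=[g\circ(f_1,\ldots,f_n)](\mathbf{a}_1+\cdots+\mathbf{a}_n)$; and $[g]\mathbf{a}\circ(f_1,\ldots,f_n)=[g\circ(f_{\mathbf{a}(1)},\ldots,f_{\mathbf{a}(m)})](\mathbf{a}\wr(k_1,\ldots,k_n))$ where $k_i$ is the arity of $f_i$. A sub-$\mathfrak{S}$-multicategory is given by subcollections of objects and of morphisms containing identities and closed under composition and under the action of $\mathfrak{S}$. A multifunctor $F:\mathcal{M}\to\mathcal{N}$ is a map on objects and maps $\mathcal{M}(A_1,\ldots,A_n;B)\to\mathcal{N}(FA_1,\ldots,FA_n;FB)$ preserving composition and identities; it is an $\mathfrak{S}$-multifunctor if also $F([f]\mathbf{a})=[F(f)]\mathbf{a}$ for $\mathbf{a}\in\mathfrak{S}$. Weakly-closed operads. An operad is a multicategory with exactly one object, written $*$; put $\mathcal{M}(n)=\mathcal{M}(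 *^n;* )$. A weakly-closed multicategory is a multicategory with, for all objects $A,B$, an object $[A,B]$ and a morphism $\mathsf{ev}_{A,B}\in\mathcal{M}([A,B],A;B)$ such that for every finite sequence $\Gamma$ of objects and $f\in\mathcal{M}(\Gamma,A;B)$ there exists (not necessarily unique) $h\in\mathcal{M}(\Gamma;[A,B])$ with $\mathsf{ev}_{A,B}\circ(h,1_A)=f$. For an operad write $\mathsf{ev}=\mathsf{ev}_{*,*}\in\mathcal{M}(2)$. A multifunctor $F$ of weakly-closed multicategories is weakly-closed if $F[A,B]=[FA,FB]$ and $F(\mathsf{ev}_{A,B})=\mathsf{ev}_{FA,FB}$. A weakly-closed $\mathfrak{S}$-operad is an $\mathfrak{S}$-multicategory that is an operad equipped with weakly-closed structure. $\mathsf{O}_\mathfrak{S}$ is the category of weakly-closed $\mathfrak{S}$-operads and weakly-closed $\mathfrak{S}$-multifunctors. Applicative systems. An applicative system $(A,\bullet)$ in $\mathcal{M}$ is an object $A$ with $\bullet\in\mathcal{M}(A,A;A)$. Put $\bullet^0=1_A$, $\bullet^{n+1}=\bullet\circ(\bullet^n,1_A)\in\mathcal{M}(A,A^{n+1};A)$. $f\in\mathcal{M}(A^n;A)$ is $(A,\bullet)$-computable if $f=\bullet^n\circ(a,1_A^n)$ for some $a\in\mathcal{M}(;A)$. $(A,\bullet)$ is $\mathfrak{S}$-combinatory complete if every morphism of the smallest sub-$\mathfrak{S}$-multicategory of $\mathcal{M}$ containing $\bullet$ and all $a\in\mathcal{M}(;A)$ is $(A,\bullet)$-computable. $\mathsf{T}_\mathfrak{S}$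 is the category whose objects ($\mathfrak{S}$-triples) are $(\mathcal{M},A,\bullet)$ with $\mathcal{M}$ an $\mathfrak{S}$-multicategory and $(A,\bullet)$ an $\mathfrak{S}$-combinatory complete applicative system in $\mathcal{M}$, and whose morphisms $(\mathcal{M},A,\bullet)\to(\mathcal{N},B,\odot)$ are $\mathfrak{S}$-multifunctors $F:\mathcal{M}\to\mathcal{N}$ with $FA=B$ and $F(\bullet)=\odot$. The functors. $R(\mathcal{M},A,\bullet)$ is the weakly-closed $\mathfrak{S}$-operad with a morphism $\overline{f}\in R(\mathcal{M},A,\bullet)(n)$ for each $(A,\bullet)$-computable $f\in\mathcal{M}(A^n;A)$; composition, identities and $\mathfrak{S}$-action as in $\mathcal{M}$: $\overline{f}\circ(\overline{g_1},\ldots,\overline{g_n})=\overline{f\circ(g_1,\ldots,g_n)}$, $1_*=\overline{1_A}$, $[\overline{f}]\mathbf{a}=\overline{[f]\mathbf{a}}$; weakly-closed structure $[*,*]=*$, $\mathsf{ev}=\overline{\bullet}$. On a morphism $F$, $R(F)( * )=*$ and $R(F)(\overline{f})=\overline{F(f)}$. $L(\mathcal{M})=(\mathcal{M},*,\mathsf{ev})$ and $L(F)=F$. *)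

theory Defs
  imports Main "HOL-Library.FuncSet"
begin

section \<open>Clubs\<close>

text \<open>
  A morphism of Fun is given by its table of values and its target: \<open>FinFun [a\<^sub>0, ..., a\<^sub>m\<^sub>-\<^sub>1] n\<close> is
  the function \<open>m \<rightarrow> n\<close> sending \<open>j\<close> to \<open>a\<^sub>j\<close>. The set with \<open>n\<close> elements is \<open>{0, ..., n - 1}\<close>,
  which fits the indexing of lists, instead of \<open>{1, ..., n}\<close>.
\<close>

datatype fin_fun = FinFun (tab: "nat list") (tgt: nat)

definition src :: "fin_fun \<Rightarrow> nat" where
  "src a = length (tab a)"

definition Fun_arrows :: "fin_fun set" where
  "Fun_arrows = {a. \<forall>x\<in>set (tab a). x < tgt a}"

definition ff_id :: "nat \<Rightarrow> fin_fun" where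
  "ff_id n = FinFun [0..<n] n"

text \<open>\<open>ff_comp b a\<close> is \<open>b \<circ> a\<close>, meaningful when \<open>tgt a = src b\<close>.\<close>

definition ff_comp :: "fin_fun \<Rightarrow> fin_fun \<Rightarrow> fin_fun" where
  "ff_comp b a = FinFun (map (\<lambda>x. tab b ! x) (tab a)) (tgt b)"

definition ff_add :: "fin_fun \<Rightarrow> fin_fun \<Rightarrow> fin_fun" where
  "ff_add a b = FinFun (tab a @ map (\<lambda>x. x + tgt a) (tab b)) (tgt a + tgt b)"

definition ff_sum :: "fin_fun list \<Rightarrow> fin_fun" where
  "ff_sum as = foldr ff_add as (ff_id 0)"

text \<open>
  The \<open>i\<close>-th block of the target of \<open>a \<wr> (k\<^sub>0, ..., k\<^sub>n\<^sub>-\<^sub>1)\<close>, listed in order. The table of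
  \<open>a \<wr> (k\<^sub>0, ..., k\<^sub>n\<^sub>-\<^sub>1)\<close> consists of the blocks number \<open>a\<^sub>0, ..., a\<^sub>m\<^sub>-\<^sub>1\<close>, one after the other.
\<close>

definition block :: "nat list \<Rightarrow> nat \<Rightarrow> nat list" where
  "block ks i = [sum_list (take i ks)..<sum_list (take i ks) + ks ! i]"

definition wreath :: "fin_fun \<Rightarrow> nat list \<Rightarrow> fin_fun" where
  "wreath a ks = FinFun (concat (map (block ks) (tab a))) (sum_list ks)"

locale faithful_cartesian_club =
  fixes S :: "fin_fun set"
  assumes arrows: "S \<subseteq> Fun_arrows"
    and id_closed: "ff_id n \<in> S"
    and comp_closed: "\<lbrakk>a \<in> S; b \<in> S; tgt a = src b\<rbrakk> \<Longrightarrow> ff_comp b a \<in> S"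
    and add_closed: "\<lbrakk>a \<in> S; b \<in> S\<rbrakk> \<Longrightarrow> ff_add a b \<in> S"
    and wreath_closed: "\<lbrakk>a \<in> S; length ks = tgt a\<rbrakk> \<Longrightarrow> wreath a ks \<in> S"


section \<open>Multicategories\<close>

text \<open>
  The sets \<open>M(A\<^sub>1, ..., A\<^sub>n; B)\<close> are taken to be disjoint: there is one set of morphisms, and each
  morphism has a list of source objects and a target object. \<open>Mcomp M f [g\<^sub>1, ..., g\<^sub>n]\<close> is
  \<open>f \<circ> (g\<^sub>1, ..., g\<^sub>n)\<close>.
\<close>

record ('o, 'm) multicat =
  Obj :: "'o set"
  Arr :: "'m set"
  Dom :: "'m \<Rightarrow> 'o list"
  Cod :: "'m \<Rightarrow> 'o"
  Idm :: "'o \<Rightarrow> 'm"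
  Mcomp :: "'m \<Rightarrow> 'm list \<Rightarrow> 'm"

definition mhom :: "('o, 'm, 'z) multicat_scheme \<Rightarrow> 'o list \<Rightarrow> 'o \<Rightarrow> 'm set" where
  "mhom M As B = {f \<in> Arr M. Dom M f = As \<and> Cod M f = B}"

definition composable :: "('o, 'm, 'z) multicat_scheme \<Rightarrow> 'm \<Rightarrow> 'm list \<Rightarrow> bool" where
  "composable M f gs \<longleftrightarrow> f \<in> Arr M \<and> set gs \<subseteq> Arr M \<and> map (Cod M) gs = Dom M f"

locale multicategory =
  fixes M :: "('o, 'm, 'z) multicat_scheme"
  assumes Dom_Obj: "f \<in> Arr M \<Longrightarrow> set (Dom M f) \<subseteq> Obj M"
    and Cod_Obj: "f \<in> Arr M \<Longrightarrow> Cod M f \<in> Obj M"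
    and Idm_hom: "A \<in> Obj M \<Longrightarrow> Idm M A \<in> mhom M [A] A"
    and Mcomp_hom:
      "composable M f gs \<Longrightarrow> Mcomp M f gs \<in> mhom M (concat (map (Dom M) gs)) (Cod M f)"
    and unit_left: "f \<in> Arr M \<Longrightarrow> Mcomp M (Idm M (Cod M f)) [f] = f"
    and unit_right: "f \<in> Arr M \<Longrightarrow> Mcomp M f (map (Idm M) (Dom M f)) = f"
    and assoc:
      "\<lbrakk>composable M f gs; list_all2 (composable M) gs hss\<rbrakk> \<Longrightarrow>
        Mcomp M (Mcomp M f gs) (concat hss) = Mcomp M f (map2 (Mcomp M) gs hss)"

text \<open>
  For \<open>a : m \<rightarrow> n\<close>, \<open>Act M f a [A\<^sub>1, ..., A\<^sub>n]\<close> is \<open>[f]a\<close> as a morphism from \<open>A\<^sub>1, ..., A\<^sub>n\<close>. The list has to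
  be supplied because \<open>f\<close> only determines the objects \<open>A\<^sub>i\<close> with \<open>i\<close> in the image of \<open>a\<close>.
\<close>

record ('o, 'm) smulticat = "('o, 'm) multicat" +
  Act :: "'m \<Rightarrow> fin_fun \<Rightarrow> 'o list \<Rightarrow> 'm"

definition actable ::
  "fin_fun set \<Rightarrow> ('o, 'm, 'z) smulticat_scheme \<Rightarrow> 'm \<Rightarrow> fin_fun \<Rightarrow> 'o list \<Rightarrow> bool" where
  "actable S M f a As \<longleftrightarrow>
    f \<in> Arr M \<and> a \<in> S \<and> set As \<subseteq> Obj M \<and> length As = tgt a \<and> Dom M f = map (\<lambda>i. As ! i) (tab a)"

locale S_multicategory = multicategory M
  for S :: "fin_fun set" and M :: "('o, 'm, 'z) smulticat_scheme" +
  assumes Act_hom: "actable S M f a As \<Longrightarrow> Act M f a As \<in> mhom M As (Cod M f)"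
    and Act_Act:
      "\<lbrakk>actable S M f a As; actable S M (Act M f a As) b Bs\<rbrakk> \<Longrightarrow>
        Act M (Act M f a As) b Bs = Act M f (ff_comp b a) Bs"
    and Act_id: "f \<in> Arr M \<Longrightarrow> Act M f (ff_id (length (Dom M f))) (Dom M f) = f"
    and Mcomp_Act_right:
      "\<lbrakk>composable M g (map fst ts); \<forall>(f, a, As)\<in>set ts. actable S M f a As\<rbrakk> \<Longrightarrow>
        Mcomp M g (map (\<lambda>(f, a, As). Act M f a As) ts) =
        Act M (Mcomp M g (map fst ts)) (ff_sum (map (\<lambda>(f, a, As). a) ts))
          (concat (map (\<lambda>(f, a, As). As) ts))"
    and Mcomp_Act_left:
      "\<lbrakk>actable S M g a As; composable M (Act M g a As) fs\<rbrakk> \<Longrightarrow>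
        Mcomp M (Act M g a As) fs =
        Act M (Mcomp M g (map (\<lambda>i. fs ! i) (tab a))) (wreath a (map (\<lambda>f. length (Dom M f)) fs))
          (concat (map (Dom M) fs))"

definition sub_S_multicategory ::
  "fin_fun set \<Rightarrow> ('o, 'm, 'z) smulticat_scheme \<Rightarrow> 'o set \<Rightarrow> 'm set \<Rightarrow> bool" where
  "sub_S_multicategory S M Os Ms \<longleftrightarrow>
    Os \<subseteq> Obj M \<and> Ms \<subseteq> Arr M \<and>
    (\<forall>f\<in>Ms. set (Dom M f) \<subseteq> Os \<and> Cod M f \<in> Os) \<and>
    (\<forall>A\<in>Os. Idm M A \<in> Ms) \<and>
    (\<forall>f gs. f \<in> Ms \<and> set gs \<subseteq> Ms \<and> composable M f gs \<longrightarrow> Mcomp M f gs \<in> Ms) \<and>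
    (\<forall>f a As. f \<in> Ms \<and> set As \<subseteq> Os \<and> actable S M f a As \<longrightarrow> Act M f a As \<in> Ms)"

text \<open>
  A multifunctor is a pair of a map on objects and a map on morphisms. Both are required to be
  extensional (\<open>undefined\<close> off the objects, resp. morphisms, of the source), so that two
  multifunctors are equal as soon as they agree on the source.
\<close>

type_synonym ('o, 'm, 'p, 'n) mfun = "('o \<Rightarrow> 'p) \<times> ('m \<Rightarrow> 'n)"

definition multifunctor ::
  "('o, 'm, 'y) multicat_scheme \<Rightarrow> ('p, 'n, 'z) multicat_scheme \<Rightarrow> ('o, 'm, 'p, 'n) mfun \<Rightarrow> bool"
where
  "multifunctor M N F \<longleftrightarrow>
    fst F \<in> Obj M \<rightarrow>\<^sub>E Obj N \<and> snd F \<in> Arr M \<rightarrow>\<^sub>E Arr N \<and>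
    (\<forall>f\<in>Arr M. Dom N (snd F f) = map (fst F) (Dom M f) \<and> Cod N (snd F f) = fst F (Cod M f)) \<and>
    (\<forall>A\<in>Obj M. snd F (Idm M A) = Idm N (fst F A)) \<and>
    (\<forall>f gs. composable M f gs \<longrightarrow> snd F (Mcomp M f gs) = Mcomp N (snd F f) (map (snd F) gs))"

definition S_multifunctor ::
  "fin_fun set \<Rightarrow> ('o, 'm, 'y) smulticat_scheme \<Rightarrow> ('p, 'n, 'z) smulticat_scheme \<Rightarrow>
    ('o, 'm, 'p, 'n) mfun \<Rightarrow> bool"
where
  "S_multifunctor S M N F \<longleftrightarrow>
    multifunctor M N F \<and>
    (\<forall>f a As. actable S M f a As \<longrightarrow> snd F (Act M f a As) = Act N (snd F f) a (map (fst F) As))"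

definition mfun_id :: "('o, 'm, 'z) multicat_scheme \<Rightarrow> ('o, 'm, 'o, 'm) mfun" where
  "mfun_id M = (\<lambda>A\<in>Obj M. A, \<lambda>f\<in>Arr M. f)"

text \<open>\<open>mfun_comp M G F\<close> is \<open>G \<circ> F\<close>, where \<open>M\<close> is the source of \<open>F\<close>.\<close>

definition mfun_comp ::
  "('o, 'm, 'z) multicat_scheme \<Rightarrow> ('p, 'n, 'q, 'k) mfun \<Rightarrow> ('o, 'm, 'p, 'n) mfun \<Rightarrow>
    ('o, 'm, 'q, 'k) mfun"
where
  "mfun_comp M G F = (compose (Obj M) (fst G) (fst F), compose (Arr M) (snd G) (snd F))"


section \<open>Weakly-closed operads\<close>

definition operad :: "('o, 'm, 'z) multicat_scheme \<Rightarrow> bool" where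
  "operad M \<longleftrightarrow> multicategory M \<and> (\<exists>x. Obj M = {x})"

definition the_obj :: "('o, 'm, 'z) multicat_scheme \<Rightarrow> 'o" where
  "the_obj M = the_elem (Obj M)"

definition weakly_closed ::
  "('o, 'm, 'z) multicat_scheme \<Rightarrow> ('o \<Rightarrow> 'o \<Rightarrow> 'o) \<Rightarrow> ('o \<Rightarrow> 'o \<Rightarrow> 'm) \<Rightarrow> bool" where
  "weakly_closed M ihom ev \<longleftrightarrow>
    multicategory M \<and>
    (\<forall>A\<in>Obj M. \<forall>B\<in>Obj M.
      ihom A B \<in> Obj M \<and>
      ev A B \<in> mhom M [ihom A B, A] B \<and>
      (\<forall>\<Gamma> f. set \<Gamma> \<subseteq> Obj M \<and> f \<in> mhom M (\<Gamma> @ [A]) B \<longrightarrow>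
        (\<exists>h\<in>mhom M \<Gamma> (ihom A B). Mcomp M (ev A B) [h, Idm M A] = f)))"

type_synonym ('o, 'm) wc_smulticat =
  "('o, 'm) smulticat \<times> ('o \<Rightarrow> 'o \<Rightarrow> 'o) \<times> ('o \<Rightarrow> 'o \<Rightarrow> 'm)"

definition wc_S_operad :: "fin_fun set \<Rightarrow> ('o, 'm) wc_smulticat \<Rightarrow> bool" where
  "wc_S_operad S = (\<lambda>(M, ihom, ev). S_multicategory S M \<and> operad M \<and> weakly_closed M ihom ev)"

definition wc_S_multifunctor ::
  "fin_fun set \<Rightarrow> ('o, 'm) wc_smulticat \<Rightarrow> ('p, 'n) wc_smulticat \<Rightarrow> ('o, 'm, 'p, 'n) mfun \<Rightarrow> bool"
where
  "wc_S_multifunctor S = (\<lambda>(M, ihom, ev) (N, ihom', ev') F.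
    S_multifunctor S M N F \<and>
    (\<forall>A\<in>Obj M. \<forall>B\<in>Obj M.
      fst F (ihom A B) = ihom' (fst F A) (fst F B) \<and>
      snd F (ev A B) = ev' (fst F A) (fst F B)))"


section \<open>Applicative systems\<close>

definition applicative_system :: "('o, 'm, 'z) multicat_scheme \<Rightarrow> 'o \<Rightarrow> 'm \<Rightarrow> bool" where
  "applicative_system M A b \<longleftrightarrow> A \<in> Obj M \<and> b \<in> mhom M [A, A] A"

fun app_pow :: "('o, 'm, 'z) multicat_scheme \<Rightarrow> 'o \<Rightarrow> 'm \<Rightarrow> nat \<Rightarrow> 'm" where
  "app_pow M A b 0 = Idm M A"
| "app_pow M A b (Suc n) = Mcomp M b [app_pow M A b n, Idm M A]"

definition computable :: "('o, 'm, 'z) multicat_scheme \<Rightarrow> 'o \<Rightarrow> 'm \<Rightarrow> 'm \<Rightarrow> bool" where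
  "computable M A b f \<longleftrightarrow>
    (\<exists>n. f \<in> mhom M (replicate n A) A \<and>
      (\<exists>a\<in>mhom M [] A. f = Mcomp M (app_pow M A b n) (a # replicate n (Idm M A))))"

text \<open>
  The morphisms of the smallest sub-\<open>S\<close>-multicategory of \<open>M\<close> containing \<open>b\<close> and all elements of
  \<open>M(;A)\<close>.
\<close>

definition generated_arrows ::
  "fin_fun set \<Rightarrow> ('o, 'm, 'z) smulticat_scheme \<Rightarrow> 'o \<Rightarrow> 'm \<Rightarrow> 'm set" where
  "generated_arrows S M A b =
    \<Inter>{Ms. \<exists>Os. sub_S_multicategory S M Os Ms \<and> b \<in> Ms \<and> mhom M [] A \<subseteq> Ms}"

definition combinatory_complete ::
  "fin_fun set \<Rightarrow> ('o, 'm, 'z) smulticat_scheme \<Rightarrow> 'o \<Rightarrow> 'm \<Rightarrow> bool" where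
  "combinatory_complete S M A b \<longleftrightarrow> (\<forall>f\<in>generated_arrows S M A b. computable M A b f)"

type_synonym ('o, 'm) triple = "('o, 'm) smulticat \<times> 'o \<times> 'm"

definition S_triple :: "fin_fun set \<Rightarrow> ('o, 'm) triple \<Rightarrow> bool" where
  "S_triple S = (\<lambda>(M, A, b).
    S_multicategory S M \<and> applicative_system M A b \<and> combinatory_complete S M A b)"

definition triple_morphism ::
  "fin_fun set \<Rightarrow> ('o, 'm) triple \<Rightarrow> ('p, 'n) triple \<Rightarrow> ('o, 'm, 'p, 'n) mfun \<Rightarrow> bool" where
  "triple_morphism S = (\<lambda>(M, A, b) (N, B, c) F.
    S_multifunctor S M N F \<and> fst F A = B \<and> snd F b = c)"


section \<open>Categories, functors and adjunctions\<close>

text \<open>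
  Hom-sets may overlap, so identity and composition, and the action of functors on morphisms, take
  the objects as arguments: for \<open>f : X \<rightarrow> Y\<close> and \<open>g : Y \<rightarrow> Z\<close>, \<open>g \<circ> f\<close> is \<open>CComp C X Y Z g f\<close>.
\<close>

record ('a, 'f) cat =
  Ob :: "'a set"
  Hom :: "'a \<Rightarrow> 'a \<Rightarrow> 'f set"
  CId :: "'a \<Rightarrow> 'f"
  CComp :: "'a \<Rightarrow> 'a \<Rightarrow> 'a \<Rightarrow> 'f \<Rightarrow> 'f \<Rightarrow> 'f"

locale category =
  fixes C :: "('a, 'f) cat"
  assumes CId_Hom: "X \<in> Ob C \<Longrightarrow> CId C X \<in> Hom C X X"
    and CComp_Hom:
      "\<lbrakk>X \<in> Ob C; Y \<in> Ob C; Z \<in> Ob C; f \<in> Hom C X Y; g \<in> Hom C Y Z\<rbrakk> \<Longrightarrow>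
        CComp C X Y Z g f \<in> Hom C X Z"
    and CId_left:
      "\<lbrakk>X \<in> Ob C; Y \<in> Ob C; f \<in> Hom C X Y\<rbrakk> \<Longrightarrow> CComp C X Y Y (CId C Y) f = f"
    and CId_right:
      "\<lbrakk>X \<in> Ob C; Y \<in> Ob C; f \<in> Hom C X Y\<rbrakk> \<Longrightarrow> CComp C X X Y f (CId C X) = f"
    and CComp_assoc:
      "\<lbrakk>W \<in> Ob C; X \<in> Ob C; Y \<in> Ob C; Z \<in> Ob C;
        f \<in> Hom C W X; g \<in> Hom C X Y; h \<in> Hom C Y Z\<rbrakk> \<Longrightarrow>
        CComp C W X Z (CComp C X Y Z h g) f = CComp C W Y Z h (CComp C W X Y g f)"

definition isomorphism :: "('a, 'f) cat \<Rightarrow> 'a \<Rightarrow> 'a \<Rightarrow> 'f \<Rightarrow> bool" where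
  "isomorphism C X Y f \<longleftrightarrow>
    f \<in> Hom C X Y \<and>
    (\<exists>g\<in>Hom C Y X. CComp C X Y X g f = CId C X \<and> CComp C Y X Y f g = CId C Y)"

record ('a, 'f, 'b, 'g) cfun =
  FOb :: "'a \<Rightarrow> 'b"
  FAr :: "'a \<Rightarrow> 'a \<Rightarrow> 'f \<Rightarrow> 'g"

locale cat_functor = C: category C + D: category D
  for C :: "('a, 'f) cat" and D :: "('b, 'g) cat" and F :: "('a, 'f, 'b, 'g) cfun" +
  assumes FOb_Ob: "X \<in> Ob C \<Longrightarrow> FOb F X \<in> Ob D"
    and FAr_Hom:
      "\<lbrakk>X \<in> Ob C; Y \<in> Ob C; f \<in> Hom C X Y\<rbrakk> \<Longrightarrow> FAr F X Y f \<in> Hom D (FOb F X) (FOb F Y)"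
    and FAr_CId: "X \<in> Ob C \<Longrightarrow> FAr F X X (CId C X) = CId D (FOb F X)"
    and FAr_CComp:
      "\<lbrakk>X \<in> Ob C; Y \<in> Ob C; Z \<in> Ob C; f \<in> Hom C X Y; g \<in> Hom C Y Z\<rbrakk> \<Longrightarrow>
        FAr F X Z (CComp C X Y Z g f) =
        CComp D (FOb F X) (FOb F Y) (FOb F Z) (FAr F Y Z g) (FAr F X Y f)"

definition cfun_id :: "('a, 'f, 'a, 'f) cfun" where
  "cfun_id = \<lparr>FOb = (\<lambda>X. X), FAr = (\<lambda>X Y f. f)\<rparr>"

definition cfun_comp ::
  "('b, 'g, 'c, 'h) cfun \<Rightarrow> ('a, 'f, 'b, 'g) cfun \<Rightarrow> ('a, 'f, 'c, 'h) cfun" where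
  "cfun_comp G F =
    \<lparr>FOb = (\<lambda>X. FOb G (FOb F X)), FAr = (\<lambda>X Y f. FAr G (FOb F X) (FOb F Y) (FAr F X Y f))\<rparr>"

definition natural_transformation ::
  "('a, 'f) cat \<Rightarrow> ('b, 'g) cat \<Rightarrow> ('a, 'f, 'b, 'g) cfun \<Rightarrow> ('a, 'f, 'b, 'g) cfun \<Rightarrow>
    ('a \<Rightarrow> 'g) \<Rightarrow> bool"
where
  "natural_transformation C D F G \<tau> \<longleftrightarrow>
    (\<forall>X\<in>Ob C. \<tau> X \<in> Hom D (FOb F X) (FOb G X)) \<and>
    (\<forall>X\<in>Ob C. \<forall>Y\<in>Ob C. \<forall>f\<in>Hom C X Y.
      CComp D (FOb F X) (FOb F Y) (FOb G Y) (\<tau> Y) (FAr F X Y f) =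
      CComp D (FOb F X) (FOb G X) (FOb G Y) (FAr G X Y f) (\<tau> X))"

text \<open>
  \<open>L : C \<rightarrow> D\<close> is left adjoint to \<open>R : D \<rightarrow> C\<close>, with unit \<open>\<eta> : 1 \<rightarrow> R L\<close> and counit \<open>\<epsilon> : L R \<rightarrow> 1\<close>.
\<close>

definition adjunction ::
  "('a, 'f) cat \<Rightarrow> ('b, 'g) cat \<Rightarrow> ('a, 'f, 'b, 'g) cfun \<Rightarrow> ('b, 'g, 'a, 'f) cfun \<Rightarrow>
    ('a \<Rightarrow> 'f) \<Rightarrow> ('b \<Rightarrow> 'g) \<Rightarrow> bool"
where
  "adjunction C D L R \<eta> \<epsilon> \<longleftrightarrow>
    cat_functor C D L \<and> cat_functor D C R \<and>
    natural_transformation C C cfun_id (cfun_comp R L) \<eta> \<and>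
    natural_transformation D D (cfun_comp L R) cfun_id \<epsilon> \<and>
    (\<forall>X\<in>Ob C.
      CComp D (FOb L X) (FOb L (FOb R (FOb L X))) (FOb L X)
        (\<epsilon> (FOb L X)) (FAr L X (FOb R (FOb L X)) (\<eta> X)) =
      CId D (FOb L X)) \<and>
    (\<forall>Y\<in>Ob D.
      CComp C (FOb R Y) (FOb R (FOb L (FOb R Y))) (FOb R Y)
        (FAr R (FOb L (FOb R Y)) Y (\<epsilon> Y)) (\<eta> (FOb R Y)) =
      CId C (FOb R Y))"


section \<open>The categories of operads and of triples, and the functors between them\<close>

definition O_cat ::
  "fin_fun set \<Rightarrow> (('o, 'm) wc_smulticat, ('o, 'm, 'o, 'm) mfun) cat" where
  "O_cat S =
    \<lparr>Ob = {X. wc_S_operad S X},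
     Hom = (\<lambda>X Y. {F. wc_S_multifunctor S X Y F}),
     CId = (\<lambda>X. mfun_id (fst X)),
     CComp = (\<lambda>X Y Z G F. mfun_comp (fst X) G F)\<rparr>"

definition T_cat ::
  "fin_fun set \<Rightarrow> (('o, 'm) triple, ('o, 'm, 'o, 'm) mfun) cat" where
  "T_cat S =
    \<lparr>Ob = {X. S_triple S X},
     Hom = (\<lambda>X Y. {F. triple_morphism S X Y F}),
     CId = (\<lambda>X. mfun_id (fst X)),
     CComp = (\<lambda>X Y Z G F. mfun_comp (fst X) G F)\<rparr>"

definition L_obj :: "('o, 'm) wc_smulticat \<Rightarrow> ('o, 'm) triple" where
  "L_obj = (\<lambda>(M, ihom, ev). (M, the_obj M, ev (the_obj M) (the_obj M)))"

definition L_fun ::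
  "(('o, 'm) wc_smulticat, ('o, 'm, 'o, 'm) mfun, ('o, 'm) triple, ('o, 'm, 'o, 'm) mfun) cfun"
where
  "L_fun = \<lparr>FOb = L_obj, FAr = (\<lambda>X Y F. F)\<rparr>"

text \<open>
  The computable \<open>f\<close> itself serves as the morphism written with a bar over \<open>f\<close>; only its source and
  target change, from copies of \<open>A\<close> to copies of \<open>pt\<close>, where \<open>pt\<close> is the object written \<open>*\<close>.
\<close>

definition R_multicat :: "'o \<Rightarrow> ('o, 'm) triple \<Rightarrow> ('o, 'm) smulticat" where
  "R_multicat pt = (\<lambda>(M, A, b).
    \<lparr>Obj = {pt},
     Arr = {f. computable M A b f},
     Dom = (\<lambda>f. replicate (length (Dom M f)) pt),
     Cod = (\<lambda>f. pt),
     Idm = (\<lambda>x. Idm M A),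
     Mcomp = Mcomp M,
     Act = (\<lambda>f a xs. Act M f a (replicate (length xs) A))\<rparr>)"

definition R_obj :: "'o \<Rightarrow> ('o, 'm) triple \<Rightarrow> ('o, 'm) wc_smulticat" where
  "R_obj pt = (\<lambda>(M, A, b). (R_multicat pt (M, A, b), \<lambda>x y. pt, \<lambda>x y. b))"

definition R_fun ::
  "'o \<Rightarrow>
    (('o, 'm) triple, ('o, 'm, 'o, 'm) mfun, ('o, 'm) wc_smulticat, ('o, 'm, 'o, 'm) mfun) cfun"
where
  "R_fun pt =
    \<lparr>FOb = R_obj pt,
     FAr = (\<lambda>X Y F. (\<lambda>x\<in>{pt}. pt, \<lambda>f\<in>Arr (R_multicat pt X). snd F f))\<rparr>"

end

theory Submission
  imports Defs
begin

text \<open>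
  For a combinatory complete applicative system \<open>(A, \<bullet>)\<close> the computable morphisms are exactly the
  morphisms of the sub-multicategory generated by \<open>\<bullet>\<close> and the elements of \<open>A\<close>, hence are closed
  under composition and the action, and \<open>\<bullet>\<^sup>n\<^sup>+\<^sup>1 \<circ> (a, 1\<^sup>n\<^sup>+\<^sup>1) = \<bullet> \<circ> (\<bullet>\<^sup>n \<circ> (a, 1\<^sup>n), 1)\<close>
  makes them weakly closed. Conversely, iterating this identity in a weakly-closed operad shows that
  every morphism there is computable. So the unit is the identity on morphisms, and the counit is
  the inclusion of the computable morphisms.
\<close>

section \<open>Multifunctors\<close>

lemma mhomD:
  assumes "f \<in> mhom M As B"
  shows "f \<in> Arr M" "Dom M f = As" "Cod M f = B"
  using assms by (auto simp: mhom_def)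

lemma list_eq_replicate: "set xs \<subseteq> {x} \<Longrightarrow> xs = replicate (length xs) x"
  by (induction xs) auto

lemma concat_map_replicate:
  "concat (map (\<lambda>t. replicate (n t) x) ts) = replicate (sum_list (map n ts)) x"
  by (induction ts) (auto simp: replicate_add)

section \<open>Multifunctors preserve sources, targets and composability\<close>

context
  fixes M :: "('o, 'm, 'y) multicat_scheme" and N :: "('p, 'n, 'z) multicat_scheme"
    and F :: "('o, 'm, 'p, 'n) mfun"
  assumes F: "multifunctor M N F"
begin

lemma multifunctor_Obj: "A \<in> Obj M \<Longrightarrow> fst F A \<in> Obj N"
  using F by (auto simp: multifunctor_def)

lemma multifunctor_Arr: "f \<in> Arr M \<Longrightarrow> snd F f \<in> Arr N"
  using F by (auto simp: multifunctor_def)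

lemma multifunctor_Dom: "f \<in> Arr M \<Longrightarrow> Dom N (snd F f) = map (fst F) (Dom M f)"
  using F by (auto simp: multifunctor_def)

lemma multifunctor_Cod: "f \<in> Arr M \<Longrightarrow> Cod N (snd F f) = fst F (Cod M f)"
  using F by (auto simp: multifunctor_def)

lemma multifunctor_Idm: "A \<in> Obj M \<Longrightarrow> snd F (Idm M A) = Idm N (fst F A)"
  using F by (auto simp: multifunctor_def)

lemma multifunctor_Mcomp:
  "composable M f gs \<Longrightarrow> snd F (Mcomp M f gs) = Mcomp N (snd F f) (map (snd F) gs)"
  using F by (auto simp: multifunctor_def)

lemma multifunctor_mhom:
  "f \<in> mhom M As B \<Longrightarrow> snd F f \<in> mhom N (map (fst F) As) (fst F B)"
  by (auto simp: mhom_def multifunctor_Arr multifunctor_Dom multifunctor_Cod)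

lemma multifunctor_composable:
  assumes "composable M f gs"
  shows "composable N (snd F f) (map (snd F) gs)"
proof -
  have "set gs \<subseteq> Arr M"
    using assms by (simp add: composable_def)
  then have "map (Cod N) (map (snd F) gs) = map (fst F) (map (Cod M) gs)"
    by (auto simp: multifunctor_Cod)
  then show ?thesis
    using assms by (auto simp: composable_def multifunctor_Arr multifunctor_Dom simp del: map_map)
qed

end

lemma S_multifunctorD: "S_multifunctor S M N F \<Longrightarrow> multifunctor M N F"
  by (simp add: S_multifunctor_def)

text \<open>The source of \<open>f\<close> is read off from \<open>As\<close> by indexing with the
  values of \<open>a\<close>. Applying \<open>fst F\<close> commutes with this indexing because
  \<open>S \<subseteq> Fun_arrows\<close> keeps all values of \<open>a\<close> below
  \<open>length As\<close>.\<close>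

lemma S_multifunctor_actable:
  assumes F: "S_multifunctor S M N F" and act: "actable S M f a As" and "S \<subseteq> Fun_arrows"
  shows "actable S N (snd F f) a (map (fst F) As)"
proof -
  have mf: "multifunctor M N F"
    using F by (rule S_multifunctorD)
  have "\<forall>i\<in>set (tab a). i < length As"
    using act assms(3) by (auto simp: actable_def Fun_arrows_def)
  then show ?thesis
    using act by (auto simp: actable_def multifunctor_Arr[OF mf] multifunctor_Dom[OF mf]
        intro: multifunctor_Obj[OF mf])
qed

section \<open>Identity and composite multifunctors\<close>

lemma (in multicategory) Mcomp_Arr:
  assumes "composable M f gs"
  shows "Mcomp M f gs \<in> Arr M" "Dom M (Mcomp M f gs) = concat (map (Dom M) gs)"
    "Cod M (Mcomp M f gs) = Cod M f"
  using mhomD[OF Mcomp_hom[OF assms]] by auto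

lemma (in multicategory) multifunctor_id: "multifunctor M M (mfun_id M)"
proof -
  \<comment> \<open>The restricted identity is \<open>undefined\<close> off \<open>Obj M\<close>; it
    fixes this list because the sources of a morphism are objects. The same caution is needed below
    for lists of morphisms.\<close>
  have "map (\<lambda>A\<in>Obj M. A) (Dom M f) = Dom M f" if "f \<in> Arr M" for f
    using Dom_Obj[OF that] by (auto intro!: map_idI)
  moreover have "map (\<lambda>f\<in>Arr M. f) gs = gs" if "composable M f gs" for f gs
    using that by (auto simp: composable_def intro!: map_idI)
  ultimately show ?thesis
    using Mcomp_Arr(1) mhomD(1)[OF Idm_hom] Cod_Obj
    by (auto simp: multifunctor_def mfun_id_def composable_def)
qed

lemma (in S_multicategory) S_multifunctor_id: "S_multifunctor S M M (mfun_id M)"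
proof -
  have "map (\<lambda>A\<in>Obj M. A) As = As" if "set As \<subseteq> Obj M" for As
    using that by (auto intro!: map_idI)
  then show ?thesis
    using multifunctor_id mhomD(1)[OF Act_hom]
    by (auto simp: S_multifunctor_def mfun_id_def) (auto simp: actable_def)
qed

lemma multifunctor_comp:
  assumes "multicategory M" "multifunctor M N F" "multifunctor N K G"
  shows "multifunctor M K (mfun_comp M G F)"
proof -
  interpret multicategory M by fact
  note F = assms(2) and G = assms(3)
  \<comment> \<open>\<open>compose\<close> is extensional, so it may be unfolded to ordinary
    composition only on lists that lie in \<open>M\<close>.\<close>
  have map_Obj: "map (compose (Obj M) (fst G) (fst F)) As = map (fst G) (map (fst F) As)"
    if "set As \<subseteq> Obj M" for As
    using that by (auto simp: compose_eq)
  have map_Arr: "map (compose (Arr M) (snd G) (snd F)) fs = map (snd G) (map (snd F) fs)"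
    if "set fs \<subseteq> Arr M" for fs
    using that by (auto simp: compose_eq)
  show ?thesis
    unfolding multifunctor_def
  proof (intro conjI ballI allI impI)
    show "fst (mfun_comp M G F) \<in> Obj M \<rightarrow>\<^sub>E Obj K"
      by (auto simp: mfun_comp_def compose_def multifunctor_Obj[OF F] multifunctor_Obj[OF G])
    show "snd (mfun_comp M G F) \<in> Arr M \<rightarrow>\<^sub>E Arr K"
      by (auto simp: mfun_comp_def compose_def multifunctor_Arr[OF F] multifunctor_Arr[OF G])
    show "Dom K (snd (mfun_comp M G F) f) = map (fst (mfun_comp M G F)) (Dom M f)"
      if "f \<in> Arr M" for f
      using that by (simp add: mfun_comp_def compose_eq map_Obj Dom_Obj multifunctor_Arr[OF F]
          multifunctor_Dom[OF F] multifunctor_Dom[OF G] del: map_map)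
    show "Cod K (snd (mfun_comp M G F) f) = fst (mfun_comp M G F) (Cod M f)"
      if "f \<in> Arr M" for f
      using that by (simp add: mfun_comp_def compose_eq Cod_Obj multifunctor_Arr[OF F]
          multifunctor_Cod[OF F] multifunctor_Cod[OF G])
    show "snd (mfun_comp M G F) (Idm M A) = Idm K (fst (mfun_comp M G F) A)"
      if "A \<in> Obj M" for A
      using that by (simp add: mfun_comp_def compose_eq mhomD(1)[OF Idm_hom]
          multifunctor_Obj[OF F] multifunctor_Idm[OF F] multifunctor_Idm[OF G])
    show "snd (mfun_comp M G F) (Mcomp M f gs) =
        Mcomp K (snd (mfun_comp M G F) f) (map (snd (mfun_comp M G F)) gs)"
      if c: "composable M f gs" for f gs
    proof -
      have "f \<in> Arr M" "set gs \<subseteq> Arr M"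
        using c by (auto simp: composable_def)
      then show ?thesis
        by (simp add: mfun_comp_def compose_eq map_Arr Mcomp_Arr[OF c] multifunctor_Mcomp[OF F c]
            multifunctor_Mcomp[OF G multifunctor_composable[OF F c]] del: map_map)
    qed
  qed
qed

lemma S_multifunctor_comp:
  assumes "S_multicategory S M" "S_multifunctor S M N F" "S_multifunctor S N K G"
    "S \<subseteq> Fun_arrows"
  shows "S_multifunctor S M K (mfun_comp M G F)"
proof -
  interpret S_multicategory S M by fact
  have "multifunctor M K (mfun_comp M G F)"
    by (intro multifunctor_comp[where N = N] multicategory_axioms S_multifunctorD[OF assms(2)]
        S_multifunctorD[OF assms(3)])
  moreover have "snd (mfun_comp M G F) (Act M f a As) =
      Act K (snd (mfun_comp M G F) f) a (map (fst (mfun_comp M G F)) As)"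
    if act: "actable S M f a As" for f a As
  proof -
    have "map (compose (Obj M) (fst G) (fst F)) As = map (fst G) (map (fst F) As)"
      using act by (auto simp: compose_eq actable_def)
    moreover have "f \<in> Arr M" "Act M f a As \<in> Arr M"
      using act mhomD(1)[OF Act_hom[OF act]] by (auto simp: actable_def)
    moreover have "snd F (Act M f a As) = Act N (snd F f) a (map (fst F) As)"
      using assms(2) act by (auto simp: S_multifunctor_def)
    moreover have "snd G (Act N (snd F f) a (map (fst F) As)) =
        Act K (snd G (snd F f)) a (map (fst G) (map (fst F) As))"
      using assms(3) S_multifunctor_actable[OF assms(2) act assms(4)]
      unfolding S_multifunctor_def by blast
    ultimately show ?thesis
      by (simp add: mfun_comp_def compose_eq del: map_map)
  qed
  ultimately show ?thesis
    by (simp add: S_multifunctor_def)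
qed

text \<open>Extensionality of multifunctors turns agreement on the source into equality, here and in
  the next two laws, so the category axioms hold strictly.\<close>

lemma mfun_comp_id_left: "multifunctor M N F \<Longrightarrow> mfun_comp M (mfun_id N) F = F"
  by (cases F) (auto simp: mfun_comp_def mfun_id_def multifunctor_def PiE_def intro!: Id_compose)

lemma mfun_comp_id_right: "multifunctor M N F \<Longrightarrow> mfun_comp M F (mfun_id M) = F"
  by (cases F) (auto simp: mfun_comp_def mfun_id_def multifunctor_def PiE_def intro!: compose_Id)

lemma mfun_comp_assoc:
  "multifunctor M N F \<Longrightarrow> mfun_comp M (mfun_comp N H G) F = mfun_comp M H (mfun_comp M G F)"
  by (auto simp: mfun_comp_def multifunctor_def PiE_def intro!: compose_assoc[symmetric])


section \<open>The categories of operads and of triples\<close>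

lemma wc_S_multifunctorD: "wc_S_multifunctor S X Y F \<Longrightarrow> S_multifunctor S (fst X) (fst Y) F"
  by (auto simp: wc_S_multifunctor_def split: prod.splits)

lemma triple_morphismD: "triple_morphism S X Y F \<Longrightarrow> S_multifunctor S (fst X) (fst Y) F"
  by (auto simp: triple_morphism_def split: prod.splits)

lemma wc_S_operadD: "wc_S_operad S X \<Longrightarrow> S_multicategory S (fst X)"
  by (auto simp: wc_S_operad_def split: prod.splits)

lemma S_tripleD: "S_triple S X \<Longrightarrow> S_multicategory S (fst X)"
  by (auto simp: S_triple_def split: prod.splits)

lemma category_O_cat:
  assumes "S \<subseteq> Fun_arrows"
  shows "category (O_cat S :: (('o, 'm) wc_smulticat, ('o, 'm, 'o, 'm) mfun) cat)"
proof
  fix W X Y Z :: "('o, 'm) wc_smulticat" and F G H :: "('o, 'm, 'o, 'm) mfun"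
  show "CId (O_cat S) X \<in> Hom (O_cat S) X X" if "X \<in> Ob (O_cat S)"
    using that S_multicategory.S_multifunctor_id[OF wc_S_operadD, of S X]
    by (auto simp: O_cat_def wc_S_multifunctor_def wc_S_operad_def weakly_closed_def mfun_id_def
        mhom_def)
  show "CComp (O_cat S) X Y Z G F \<in> Hom (O_cat S) X Z"
    if "X \<in> Ob (O_cat S)" "Y \<in> Ob (O_cat S)" "Z \<in> Ob (O_cat S)"
      "F \<in> Hom (O_cat S) X Y" "G \<in> Hom (O_cat S) Y Z"
  proof -
    obtain M i e N i' e' K i'' e'' where eq: "X = (M, i, e)" "Y = (N, i', e')" "Z = (K, i'', e'')"
      by (metis prod_cases3)
    have wc: "weakly_closed M i e" and F: "wc_S_multifunctor S X Y F"
      and G: "wc_S_multifunctor S Y Z G" and M: "S_multicategory S M"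
      using that by (auto simp: O_cat_def wc_S_operad_def eq)
    have "S_multifunctor S M K (mfun_comp M G F)"
      using S_multifunctor_comp[OF M _ _ assms] wc_S_multifunctorD[OF F] wc_S_multifunctorD[OF G]
      by (simp add: eq)
    moreover have "fst F A \<in> Obj N" if "A \<in> Obj M" for A
      using multifunctor_Obj[OF S_multifunctorD[OF wc_S_multifunctorD[OF F]]] that
      by (simp add: eq)
    \<comment> \<open>The composite has its expected value at \<open>e A B\<close> and
      \<open>i A B\<close> only once these are known to lie in \<open>M\<close>.\<close>
    moreover have "e A B \<in> Arr M" "i A B \<in> Obj M" if "A \<in> Obj M" "B \<in> Obj M" for A B
      using wc that by (auto simp: weakly_closed_def mhom_def)
    ultimately have "wc_S_multifunctor S X Z (mfun_comp M G F)"
      using F G by (auto simp: wc_S_multifunctor_def eq mfun_comp_def compose_eq)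
    then show ?thesis
      by (simp add: O_cat_def eq)
  qed
next
  fix W X Y Z :: "('o, 'm) wc_smulticat" and F G H :: "('o, 'm, 'o, 'm) mfun"
  assume "F \<in> Hom (O_cat S) X Y"
  then have F: "multifunctor (fst X) (fst Y) F"
    by (simp add: O_cat_def S_multifunctorD[OF wc_S_multifunctorD])
  show "CComp (O_cat S) X Y Y (CId (O_cat S) Y) F = F"
    by (simp add: O_cat_def mfun_comp_id_left[OF F])
  show "CComp (O_cat S) X X Y F (CId (O_cat S) X) = F"
    by (simp add: O_cat_def mfun_comp_id_right[OF F])
  show "CComp (O_cat S) X Y W (CComp (O_cat S) Y Z W H G) F =
      CComp (O_cat S) X Z W H (CComp (O_cat S) X Y Z G F)"
    by (simp add: O_cat_def mfun_comp_assoc[OF F])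
qed

lemma category_T_cat:
  assumes "S \<subseteq> Fun_arrows"
  shows "category (T_cat S :: (('o, 'm) triple, ('o, 'm, 'o, 'm) mfun) cat)"
proof
  fix W X Y Z :: "('o, 'm) triple" and F G H :: "('o, 'm, 'o, 'm) mfun"
  show "CId (T_cat S) X \<in> Hom (T_cat S) X X" if "X \<in> Ob (T_cat S)"
    using that S_multicategory.S_multifunctor_id[OF S_tripleD, of S X]
    by (auto simp: T_cat_def triple_morphism_def S_triple_def applicative_system_def mfun_id_def
        mhom_def)
  show "CComp (T_cat S) X Y Z G F \<in> Hom (T_cat S) X Z"
    if "X \<in> Ob (T_cat S)" "Y \<in> Ob (T_cat S)" "Z \<in> Ob (T_cat S)"
      "F \<in> Hom (T_cat S) X Y" "G \<in> Hom (T_cat S) Y Z"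
  proof -
    obtain M A b N A' b' K A'' b'' where eq: "X = (M, A, b)" "Y = (N, A', b')" "Z = (K, A'', b'')"
      by (metis prod_cases3)
    have "applicative_system M A b" and F: "triple_morphism S X Y F"
      and G: "triple_morphism S Y Z G" and M: "S_multicategory S M"
      using that by (auto simp: T_cat_def S_triple_def eq)
    moreover have "S_multifunctor S M K (mfun_comp M G F)"
      using S_multifunctor_comp[OF M _ _ assms] triple_morphismD[OF F] triple_morphismD[OF G]
      by (simp add: eq)
    ultimately have "triple_morphism S X Z (mfun_comp M G F)"
      by (auto simp: triple_morphism_def eq mfun_comp_def compose_eq applicative_system_def mhom_def)
    then show ?thesis
      by (simp add: T_cat_def eq)
  qed
next
  fix W X Y Z :: "('o, 'm) triple" and F G H :: "('o, 'm, 'o, 'm) mfun"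
  assume "F \<in> Hom (T_cat S) X Y"
  then have F: "multifunctor (fst X) (fst Y) F"
    by (simp add: T_cat_def S_multifunctorD[OF triple_morphismD])
  show "CComp (T_cat S) X Y Y (CId (T_cat S) Y) F = F"
    by (simp add: T_cat_def mfun_comp_id_left[OF F])
  show "CComp (T_cat S) X X Y F (CId (T_cat S) X) = F"
    by (simp add: T_cat_def mfun_comp_id_right[OF F])
  show "CComp (T_cat S) X Y W (CComp (T_cat S) Y Z W H G) F =
      CComp (T_cat S) X Z W H (CComp (T_cat S) X Y Z G F)"
    by (simp add: T_cat_def mfun_comp_assoc[OF F])
qed


section \<open>Computable morphisms\<close>

locale applicative_multicategory = S_multicategory S M
  for S :: "fin_fun set" and M :: "('o, 'm, 'z) smulticat_scheme" +
  fixes A :: 'o and b :: 'm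
  assumes app: "applicative_system M A b"
begin

lemma A_Obj: "A \<in> Obj M" and b_hom: "b \<in> mhom M [A, A] A"
  using app by (auto simp: applicative_system_def)

lemma Id_hom: "Idm M A \<in> mhom M [A] A"
  using A_Obj by (rule Idm_hom)

lemma Id_Id: "Mcomp M (Idm M A) [Idm M A] = Idm M A"
  using unit_right[OF mhomD(1)[OF Id_hom]] by (simp add: mhomD(2)[OF Id_hom])

lemma app_pow_composable:
  "p \<in> mhom M (replicate n A) A \<Longrightarrow> composable M b [p, Idm M A]"
  using mhomD[OF b_hom] mhomD[OF Id_hom] by (simp add: composable_def mhom_def)

lemma app_pow_hom: "app_pow M A b n \<in> mhom M (replicate (Suc n) A) A"
proof (induction n)
  case 0
  show ?case using Id_hom by simp
next
  case (Suc n)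
  show ?case
    using Mcomp_hom[OF app_pow_composable[OF Suc.IH]] mhomD[OF Suc.IH] mhomD[OF b_hom]
      mhomD[OF Id_hom]
    by (simp add: replicate_append_same)
qed

lemma app_pow_arg_composable:
  assumes "a \<in> mhom M [] A"
  shows "composable M (app_pow M A b n) (a # replicate n (Idm M A))"
  using mhomD[OF app_pow_hom[of n]] mhomD[OF Id_hom] mhomD[OF assms]
  by (auto simp: composable_def)

lemma app_pow_arg_hom:
  assumes "a \<in> mhom M [] A"
  shows "Mcomp M (app_pow M A b n) (a # replicate n (Idm M A)) \<in> mhom M (replicate n A) A"
proof -
  have "concat (replicate n [A]) = replicate n A"
    by (induction n) auto
  then show ?thesis
    using Mcomp_hom[OF app_pow_arg_composable[OF assms, of n]] mhomD[OF app_pow_hom[of n]]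
      mhomD[OF Id_hom] mhomD[OF assms]
    by simp
qed

text \<open>Associativity, with the argument list cut into \<open>a\<close> and \<open>n\<close>
  identities for the first input of \<open>b\<close>, and the last identity for the second input.
  This is one step of currying: it splits off the last argument of a computable morphism, and in the
  other direction it builds representing elements by induction on the arity.\<close>

lemma app_pow_Suc_arg:
  assumes a: "a \<in> mhom M [] A"
  shows "Mcomp M (app_pow M A b (Suc n)) (a # replicate (Suc n) (Idm M A)) =
    Mcomp M b [Mcomp M (app_pow M A b n) (a # replicate n (Idm M A)), Idm M A]"
proof -
  let ?hss = "[a # replicate n (Idm M A), [Idm M A]]"
  have "composable M (Idm M A) [Idm M A]"
    using mhomD[OF Id_hom] by (simp add: composable_def)
  then have "list_all2 (composable M) [app_pow M A b n, Idm M A] ?hss"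
    using app_pow_arg_composable[OF a] by simp
  from assoc[OF app_pow_composable[OF app_pow_hom] this] show ?thesis
    by (simp add: Id_Id replicate_append_same)
qed

section \<open>Computable morphisms and generated morphisms\<close>

lemma computableD:
  assumes "computable M A b f"
  shows "f \<in> Arr M" "Dom M f = replicate (length (Dom M f)) A" "Cod M f = A"
  using assms by (auto simp: computable_def mhom_def)

lemma computableI:
  assumes "a \<in> mhom M [] A" "f = Mcomp M (app_pow M A b n) (a # replicate n (Idm M A))"
  shows "computable M A b f"
  using assms app_pow_arg_hom by (auto simp: computable_def)

text \<open>A computable morphism is a composite of \<open>b\<close>, identities and an element of
  \<open>A\<close>, so it belongs to every sub-multicategory that is intersected.\<close>

lemma computable_imp_generated:
  assumes "computable M A b f"
  shows "f \<in> generated_arrows S M A b"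
  unfolding generated_arrows_def
proof (rule InterI, clarify)
  fix Ms Os
  assume sub: "sub_S_multicategory S M Os Ms" and b: "b \<in> Ms" and el: "mhom M [] A \<subseteq> Ms"
  have "Cod M b \<in> Os"
    using sub b by (auto simp: sub_S_multicategory_def)
  then have "A \<in> Os"
    using mhomD[OF b_hom] by simp
  then have Id: "Idm M A \<in> Ms"
    using sub by (auto simp: sub_S_multicategory_def)
  have comp: "Mcomp M g gs \<in> Ms" if "g \<in> Ms" "set gs \<subseteq> Ms" "composable M g gs" for g gs
    using sub that unfolding sub_S_multicategory_def by blast
  have pow: "app_pow M A b n \<in> Ms" for n
  proof (induction n)
    case (Suc n)
    then show ?case
      using comp[OF b _ app_pow_composable[OF app_pow_hom]] Id by simp
  qed (use Id in simp)
  obtain n a where a: "a \<in> mhom M [] A"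
    "f = Mcomp M (app_pow M A b n) (a # replicate n (Idm M A))"
    using assms by (auto simp: computable_def)
  show "f \<in> Ms"
    unfolding a(2) using el a(1) Id by (intro comp[OF pow _ app_pow_arg_composable]) auto
qed

text \<open>\<open>M\<close> itself is one of the sub-multicategories that are intersected.\<close>

lemma generated_Arr: "generated_arrows S M A b \<subseteq> Arr M"
proof -
  have "sub_S_multicategory S M (Obj M) (Arr M)"
    using Dom_Obj Cod_Obj mhomD(1)[OF Idm_hom] Mcomp_Arr(1) mhomD(1)[OF Act_hom]
    unfolding sub_S_multicategory_def by blast
  then show ?thesis
    using mhomD(1)[OF b_hom] unfolding generated_arrows_def by (auto simp: mhom_def)
qed

lemma generated_Mcomp:
  assumes "f \<in> generated_arrows S M A b" "set gs \<subseteq> generated_arrows S M A b" "composable M f gs"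
  shows "Mcomp M f gs \<in> generated_arrows S M A b"
  unfolding generated_arrows_def
proof (rule InterI, clarify)
  fix Ms Os
  assume sub: "sub_S_multicategory S M Os Ms" "b \<in> Ms" "mhom M [] A \<subseteq> Ms"
  then have "generated_arrows S M A b \<subseteq> Ms"
    unfolding generated_arrows_def by blast
  then have "f \<in> Ms" "set gs \<subseteq> Ms"
    using assms(1,2) by auto
  then show "Mcomp M f gs \<in> Ms"
    using sub(1) assms(3) by (simp add: sub_S_multicategory_def)
qed

text \<open>Only morphism sets are intersected, so the list of new sources must be seen to lie in
  each \<open>Os\<close> separately. Copies of \<open>A\<close> do, as \<open>A\<close> is the
  target of \<open>b\<close>, and this is the case that the operad of computable morphisms
  needs.\<close>

lemma generated_Act:
  assumes "f \<in> generated_arrows S M A b" "actable S M f a (replicate n A)"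
  shows "Act M f a (replicate n A) \<in> generated_arrows S M A b"
  unfolding generated_arrows_def
proof (rule InterI, clarify)
  fix Ms Os
  assume sub: "sub_S_multicategory S M Os Ms" "b \<in> Ms" "mhom M [] A \<subseteq> Ms"
  then have "generated_arrows S M A b \<subseteq> Ms"
    unfolding generated_arrows_def by blast
  moreover have "Cod M b \<in> Os"
    using sub by (auto simp: sub_S_multicategory_def)
  then have "set (replicate n A) \<subseteq> Os"
    using mhomD[OF b_hom] by auto
  ultimately have "f \<in> Ms" "set (replicate n A) \<subseteq> Os"
    using assms(1) by auto
  then show "Act M f a (replicate n A) \<in> Ms"
    using sub(1) assms(2) by (simp add: sub_S_multicategory_def)
qed

lemma generated_Id: "Idm M A \<in> generated_arrows S M A b"
  unfolding generated_arrows_def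
proof (rule InterI, clarify)
  fix Ms Os
  assume "sub_S_multicategory S M Os Ms" "b \<in> Ms"
  then show "Idm M A \<in> Ms"
    using mhomD(3)[OF b_hom] unfolding sub_S_multicategory_def by blast
qed

lemma generated_b: "b \<in> generated_arrows S M A b"
  unfolding generated_arrows_def by blast

end

section \<open>Multifunctors preserve computability\<close>

lemma multifunctor_app_pow:
  assumes "applicative_multicategory S M A b" "multifunctor M N F"
  shows "snd F (app_pow M A b n) = app_pow N (fst F A) (snd F b) n"
proof -
  interpret applicative_multicategory S M A b by fact
  show ?thesis
    using multifunctor_Mcomp[OF assms(2) app_pow_composable[OF app_pow_hom]]
      multifunctor_Idm[OF assms(2) A_Obj]
    by (induction n) auto
qed

text \<open>If the element \<open>a\<close> represents \<open>f\<close>, then \<open>snd F a\<close>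
  represents \<open>snd F f\<close>, since \<open>F\<close> preserves composites, identities and the
  powers of \<open>b\<close>. This makes \<open>R\<close> well defined on morphisms.\<close>

lemma multifunctor_computable:
  assumes "applicative_multicategory S M A b" "multifunctor M N F"
    "computable M A b f"
  shows "computable N (fst F A) (snd F b) (snd F f)"
proof -
  interpret applicative_multicategory S M A b by fact
  note F = assms(2)
  obtain n a where a: "a \<in> mhom M [] A" and hom: "f \<in> mhom M (replicate n A) A"
    and f: "f = Mcomp M (app_pow M A b n) (a # replicate n (Idm M A))"
    using assms(3) by (auto simp: computable_def)
  have "snd F f = Mcomp N (app_pow N (fst F A) (snd F b) n)
      (snd F a # replicate n (Idm N (fst F A)))"
    using multifunctor_Mcomp[OF F app_pow_arg_composable[OF a, of n]]
    by (simp add: f multifunctor_app_pow[OF assms(1) F] multifunctor_Idm[OF F A_Obj])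
  moreover have "snd F f \<in> mhom N (replicate n (fst F A)) (fst F A)"
    using multifunctor_mhom[OF F hom] by simp
  moreover have "snd F a \<in> mhom N [] (fst F A)"
    using multifunctor_mhom[OF F a] by simp
  ultimately show ?thesis
    unfolding computable_def by blast
qed


section \<open>The operad of computable morphisms\<close>

text \<open>\<open>pt\<close> names the single object of the operad of computable morphisms; it is
  an arbitrary value and need not be an object of \<open>M\<close>.\<close>

locale combinatory_complete_system = applicative_multicategory S M A b
  for S :: "fin_fun set" and M :: "('o, 'm) smulticat" and A :: 'o and b :: 'm +
  fixes pt :: 'o
  assumes cc: "combinatory_complete S M A b"
    and S_arrows: "S \<subseteq> Fun_arrows"
begin

abbreviation R where "R \<equiv> R_multicat pt (M, A, b)"

lemma computable_iff: "computable M A b f \<longleftrightarrow> f \<in> generated_arrows S M A b"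
  using cc computable_imp_generated by (auto simp: combinatory_complete_def)

lemma R_simps:
  "Obj R = {pt}" "Arr R = {f. computable M A b f}"
  "Dom R = (\<lambda>f. replicate (length (Dom M f)) pt)" "Cod R = (\<lambda>f. pt)" "Idm R x = Idm M A"
  "Mcomp R = Mcomp M" "Act R f a xs = Act M f a (replicate (length xs) A)"
  by (simp_all add: R_multicat_def)

lemma R_Arr_M: "f \<in> Arr R \<Longrightarrow> f \<in> Arr M"
  by (simp add: R_simps computableD)

text \<open>Comparing lists of copies of \<open>pt\<close> only compares lengths. The objects match
  in \<open>M\<close> as well because a computable morphism has \<open>A\<close> as its target and
  as each of its sources.\<close>

lemma composable_R:
  assumes "composable R f gs"
  shows "composable M f gs"
proof -
  have f: "computable M A b f" and gs: "\<forall>g\<in>set gs. computable M A b g"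
    and len: "replicate (length gs) pt = replicate (length (Dom M f)) pt"
    using assms by (auto simp: composable_def R_simps map_replicate_const)
  have "length gs = length (Dom M f)"
    using len by (metis length_replicate)
  moreover have "map (Cod M) gs = replicate (length gs) A"
    using gs by (auto simp: computableD(3) map_replicate_const[symmetric])
  ultimately show ?thesis
    using computableD[OF f] gs by (auto simp: composable_def computableD(1))
qed

lemma actable_R:
  assumes "actable S R f a xs"
  shows "actable S M f a (replicate (length xs) A)" "xs = replicate (length xs) pt"
proof -
  have f: "computable M A b f" and a: "a \<in> S" "length xs = tgt a"
    and dom: "replicate (length (Dom M f)) pt = map ((!) xs) (tab a)"
    using assms by (auto simp: actable_def R_simps)
  \<comment> \<open>Indexing a list of copies of \<open>A\<close> gives \<open>A\<close> only below
    its length, so the values of \<open>a\<close> have to be bounded.\<close>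
  have "\<forall>i\<in>set (tab a). i < length xs"
    using a S_arrows by (auto simp: Fun_arrows_def)
  then have "map ((!) (replicate (length xs) A)) (tab a) = replicate (length (tab a)) A"
    by (auto simp: map_replicate_const[symmetric])
  moreover have "length (Dom M f) = length (tab a)"
    using arg_cong[OF dom, of length] by simp
  ultimately show "actable S M f a (replicate (length xs) A)"
    using a computableD[OF f] A_Obj by (auto simp: actable_def)
  show "xs = replicate (length xs) pt"
    using assms by (intro list_eq_replicate) (simp add: actable_def R_simps)
qed

lemma Mcomp_R: "composable R f gs \<Longrightarrow> computable M A b (Mcomp M f gs)"
  using generated_Mcomp[OF _ _ composable_R, of f gs]
  by (auto simp: computable_iff composable_def R_simps)

lemma Act_R: "actable S R f a xs \<Longrightarrow> computable M A b (Act M f a (replicate (length xs) A))"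
  using generated_Act[OF _ actable_R(1), of f a xs]
  by (auto simp: computable_iff actable_def R_simps)

text \<open>The laws are those of \<open>M\<close>, carried over along \<open>composable_R\<close>;
  closure under composition and identities comes from the generated morphisms.\<close>

lemma multicategory_R: "multicategory R"
proof
  fix f gs hss x
  show "set (Dom R f) \<subseteq> Obj R" "Cod R f \<in> Obj R"
    by (auto simp: R_simps)
  show "Idm R x \<in> mhom R [x] x" if "x \<in> Obj R"
    using that generated_Id mhomD[OF Id_hom] by (simp add: mhom_def R_simps computable_iff)
  show "Mcomp R f gs \<in> mhom R (concat (map (Dom R) gs)) (Cod R f)" if "composable R f gs"
    using Mcomp_R[OF that] Mcomp_Arr(2)[OF composable_R[OF that]]
    by (simp add: mhom_def R_simps concat_map_replicate length_concat o_def)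
  show "Mcomp R (Idm R (Cod R f)) [f] = f" if "f \<in> Arr R"
    using unit_left[of f] R_Arr_M[OF that] that by (simp add: R_simps computableD(3))
  show "Mcomp R f (map (Idm R) (Dom R f)) = f" if "f \<in> Arr R"
    using unit_right[of f] R_Arr_M[OF that] that computableD(2)[of f]
    by (metis (no_types, lifting) R_simps(2,3,5,6) map_replicate mem_Collect_eq)
  show "Mcomp R (Mcomp R f gs) (concat hss) = Mcomp R f (map2 (Mcomp R) gs hss)"
    if "composable R f gs" "list_all2 (composable R) gs hss"
    using assoc[OF composable_R[OF that(1)]] that(2)
    by (auto simp: R_simps dest: list_all2_mono[OF _ composable_R])
qed

lemma S_multicategory_R: "S_multicategory S R"
proof -
  interpret R: multicategory R by (rule multicategory_R)
  show ?thesis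
  proof
    fix f g a as c bs ts fs
    show "Act R f a as \<in> mhom R as (Cod R f)" if "actable S R f a as"
      using Act_R[OF that] mhomD[OF Act_hom[OF actable_R(1)[OF that]]] actable_R(2)[OF that]
      by (simp add: mhom_def R_simps)
    show "Act R (Act R f a as) c bs = Act R f (ff_comp c a) bs"
      if "actable S R f a as" "actable S R (Act R f a as) c bs"
      using Act_Act[OF actable_R(1)[OF that(1)]] actable_R(1)[OF that(2)] by (simp add: R_simps)
    show "Act R f (ff_id (length (Dom R f))) (Dom R f) = f" if "f \<in> Arr R"
      using Act_id[OF R_Arr_M[OF that]] computableD(2)[of f] that by (simp add: R_simps)
    show "Mcomp R g (map (\<lambda>(f, a, As). Act R f a As) ts) =
        Act R (Mcomp R g (map fst ts)) (ff_sum (map (\<lambda>(f, a, As). a) ts))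
          (concat (map (\<lambda>(f, a, As). As) ts))"
      if "composable R g (map fst ts)" "\<forall>(f, a, As)\<in>set ts. actable S R f a As"
    proof -
      \<comment> \<open>The object lists in \<open>ts\<close> consist of copies of
        \<open>pt\<close>; the law of \<open>M\<close> is applied to lists of copies of
        \<open>A\<close> of the same lengths.\<close>
      let ?ts = "map (\<lambda>(f, a, As). (f, a, replicate (length As) A)) ts"
      have fst_ts: "map fst ?ts = map fst ts"
        by auto
      have act: "\<forall>(f, a, As)\<in>set ?ts. actable S M f a As"
        using that(2) actable_R(1) by fastforce
      have "composable M g (map fst ?ts)"
        unfolding fst_ts by (rule composable_R[OF that(1)])
      from Mcomp_Act_right[OF this act] show ?thesis
        unfolding fst_ts
        by (simp add: R_simps o_def case_prod_unfold concat_map_replicate length_concat)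
    qed
    show "Mcomp R (Act R g a as) fs =
        Act R (Mcomp R g (map (\<lambda>i. fs ! i) (tab a))) (wreath a (map (\<lambda>f. length (Dom R f)) fs))
          (concat (map (Dom R) fs))"
      if "actable S R g a as" "composable R (Act R g a as) fs"
    proof -
      \<comment> \<open>The law of \<open>M\<close> produces the actual concatenated sources,
        whereas \<open>Act R\<close> supplies copies of \<open>A\<close>; the two lists agree
        because the \<open>fs\<close> are computable.\<close>
      have "map (Dom M) fs = map (\<lambda>f. replicate (length (Dom M f)) A) fs"
        using that(2) computableD(2) by (auto simp: composable_def R_simps)
      then have "concat (map (Dom M) fs) = replicate (\<Sum>f\<leftarrow>fs. length (Dom M f)) A"
        by (simp only: concat_map_replicate)
      then show ?thesis
        using Mcomp_Act_left[OF actable_R(1)[OF that(1)]] composable_R[OF that(2)]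
        by (simp add: R_simps o_def concat_map_replicate length_concat)
    qed
  qed
qed

lemma weakly_closed_R: "weakly_closed R (\<lambda>x y. pt) (\<lambda>x y. b)"
  unfolding weakly_closed_def
proof (intro conjI ballI allI impI)
  show "multicategory R"
    by (rule multicategory_R)
  show "pt \<in> Obj R"
    by (simp add: R_simps)
  fix x y
  assume xy: "x \<in> Obj R" "y \<in> Obj R"
  show "b \<in> mhom R [pt, x] y"
    using xy generated_b mhomD[OF b_hom] by (simp add: mhom_def R_simps computable_iff)
  fix \<Gamma> f
  assume asm: "set \<Gamma> \<subseteq> Obj R \<and> f \<in> mhom R (\<Gamma> @ [x]) y"
  then have f: "computable M A b f"
    and "replicate (length (Dom M f)) pt = \<Gamma> @ [x]"
    by (auto simp: mhom_def R_simps)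
  then have len: "length (Dom M f) = Suc (length \<Gamma>)"
    by (metis length_append_singleton length_replicate)
  have \<Gamma>: "\<Gamma> = replicate (length \<Gamma>) pt"
    using asm by (intro list_eq_replicate) (simp add: R_simps)
  obtain n a where a: "a \<in> mhom M [] A" and hom: "f \<in> mhom M (replicate n A) A"
    and fa: "f = Mcomp M (app_pow M A b n) (a # replicate n (Idm M A))"
    using f by (auto simp: computable_def)
  \<comment> \<open>The source of \<open>f\<close> ends in \<open>x\<close>, so its arity is a
    successor and one argument can be split off.\<close>
  have n: "n = Suc (length \<Gamma>)"
    using len mhomD(2)[OF hom] by simp
  \<comment> \<open>The same element \<open>a\<close>, now with one argument fewer; by
    \<open>app_pow_Suc_arg\<close>, applying the result to the last argument gives back
    \<open>f\<close>.\<close>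
  let ?h = "Mcomp M (app_pow M A b (length \<Gamma>)) (a # replicate (length \<Gamma>) (Idm M A))"
  have "?h \<in> mhom R \<Gamma> pt"
    using computableI[OF a refl] mhomD(2)[OF app_pow_arg_hom[OF a]] \<Gamma>
    by (simp add: mhom_def R_simps)
  moreover have "Mcomp R b [?h, Idm R x] = f"
    using app_pow_Suc_arg[OF a] by (simp add: R_simps fa n)
  ultimately show "\<exists>h\<in>mhom R \<Gamma> pt. Mcomp R b [h, Idm R x] = f"
    by blast
qed

lemma wc_S_operad_R: "wc_S_operad S (R_obj pt (M, A, b))"
  using S_multicategory_R multicategory_R weakly_closed_R
  by (auto simp: wc_S_operad_def R_obj_def operad_def R_simps)

text \<open>This becomes the counit: morphisms are kept and only the object \<open>pt\<close> is
  sent to \<open>A\<close>. For the triple of a weakly-closed operad it is also the inverse of the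
  unit.\<close>

lemma S_multifunctor_inclusion:
  "S_multifunctor S R M (\<lambda>x\<in>{pt}. A, \<lambda>f\<in>Arr R. f)"
proof -
  have Id_R: "Idm M A \<in> Arr R"
    using generated_Id by (simp add: R_simps computable_iff)
  have "map (\<lambda>f\<in>Arr R. f) gs = gs" if "composable R f gs" for f gs
    using that by (auto simp: composable_def intro!: map_idI)
  moreover have "Mcomp R f gs \<in> Arr R" "f \<in> Arr R" if "composable R f gs" for f gs
    using Mcomp_R[OF that] that by (auto simp: R_simps composable_def)
  moreover have "Dom M f = map (\<lambda>x\<in>{pt}. A) (Dom R f)" "Cod M f = A" if "f \<in> Arr R" for f
    using computableD(2,3)[of f] that by (simp_all add: R_simps)
  ultimately have "multifunctor R M (\<lambda>x\<in>{pt}. A, \<lambda>f\<in>Arr R. f)"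
    using A_Obj R_Arr_M Id_R by (auto simp: multifunctor_def R_simps(1,4-6))
  moreover have "map (\<lambda>x\<in>{pt}. A) xs = replicate (length xs) A" "Act R f a xs \<in> Arr R"
    "f \<in> Arr R" if "actable S R f a xs" for f a xs
    using arg_cong[OF actable_R(2)[OF that], of "map (\<lambda>x\<in>{pt}. A)"] Act_R[OF that] that
    by (simp_all add: actable_def R_simps)
  ultimately show ?thesis
    by (simp add: S_multifunctor_def R_simps(7))
qed

end

lemma S_triple_iff:
  assumes "S \<subseteq> Fun_arrows"
  shows "S_triple S (M, A, b) \<longleftrightarrow> combinatory_complete_system S M A b"
  using assms by (auto simp: S_triple_def combinatory_complete_system_def
      applicative_multicategory_def combinatory_complete_system_axioms_def
      applicative_multicategory_axioms_def)


section \<open>The adjunction\<close>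

locale wc_operad =
  fixes S :: "fin_fun set" and M :: "('o, 'm) smulticat" and ihom ev and pt :: 'o
  assumes wc: "wc_S_operad S (M, ihom, ev)"
    and S_arrows: "S \<subseteq> Fun_arrows"
begin

abbreviation "ast \<equiv> the_obj M"
abbreviation "bul \<equiv> ev ast ast"

lemma Obj_M: "Obj M = {ast}"
proof -
  obtain x where "Obj M = {x}"
    using wc by (auto simp: wc_S_operad_def operad_def)
  then show ?thesis
    by (simp add: the_obj_def)
qed

text \<open>With a single object, \<open>[*,*]\<close> can only be \<open>*\<close>. So
  \<open>ev\<close> is a binary operation on \<open>*\<close>, and passing from \<open>f\<close> to
  \<open>h\<close> lowers the arity by one without changing the target.\<close>

lemma weakly_closed_M:
  "ihom ast ast = ast" "bul \<in> mhom M [ast, ast] ast"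
  "f \<in> mhom M (replicate n ast @ [ast]) ast \<Longrightarrow>
    \<exists>h\<in>mhom M (replicate n ast) ast. Mcomp M bul [h, Idm M ast] = f"
proof -
  have "set (replicate n ast) \<subseteq> Obj M" "ast \<in> Obj M"
    by (simp_all add: Obj_M set_replicate_conv_if)
  moreover have "weakly_closed M ihom ev"
    using wc by (simp add: wc_S_operad_def)
  ultimately have *: "ihom ast ast \<in> Obj M" "bul \<in> mhom M [ihom ast ast, ast] ast"
    "f \<in> mhom M (replicate n ast @ [ast]) ast \<longrightarrow>
      (\<exists>h\<in>mhom M (replicate n ast) (ihom ast ast). Mcomp M bul [h, Idm M ast] = f)"
    unfolding weakly_closed_def by blast+
  show ihom: "ihom ast ast = ast"
    using *(1) unfolding Obj_M by (rule singletonD)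
  show "bul \<in> mhom M [ast, ast] ast"
    "f \<in> mhom M (replicate n ast @ [ast]) ast \<Longrightarrow>
      \<exists>h\<in>mhom M (replicate n ast) ast. Mcomp M bul [h, Idm M ast] = f"
    using *(2,3) unfolding ihom by blast+
qed

lemma ihom_ast: "x \<in> Obj M \<Longrightarrow> y \<in> Obj M \<Longrightarrow> ihom x y = ast"
  unfolding Obj_M by (simp add: weakly_closed_M(1))

sublocale applicative_multicategory S M ast bul
proof -
  have "applicative_system M ast bul"
    using Obj_M weakly_closed_M(2) by (simp add: applicative_system_def)
  then show "applicative_multicategory S M ast bul"
    using wc by (simp add: applicative_multicategory_def applicative_multicategory_axioms_def
        wc_S_operad_def)
qed

lemma Dom_replicate: "f \<in> Arr M \<Longrightarrow> Dom M f = replicate (length (Dom M f)) ast"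
  using Dom_Obj Obj_M by (intro list_eq_replicate) auto

lemma Cod_ast: "f \<in> Arr M \<Longrightarrow> Cod M f = ast"
  using Cod_Obj Obj_M by auto

text \<open>Induction on the arity: weak closure yields \<open>h\<close> with one argument fewer,
  the induction hypothesis represents \<open>h\<close> by an element \<open>a\<close>, and
  \<open>app_pow_Suc_arg\<close> shows that the same \<open>a\<close> represents
  \<open>f\<close>.\<close>

lemma app_pow_representation:
  assumes "f \<in> mhom M (replicate n ast) ast"
  shows "\<exists>a\<in>mhom M [] ast. f = Mcomp M (app_pow M ast bul n) (a # replicate n (Idm M ast))"
  using assms
proof (induction n arbitrary: f)
  case 0
  \<comment> \<open>A nullary \<open>f\<close> represents itself, since the zeroth power is the
    identity.\<close>
  then show ?case
    using unit_left[of f] by (auto simp: mhom_def intro!: bexI[of _ f])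
next
  case (Suc n)
  then have "f \<in> mhom M (replicate n ast @ [ast]) ast"
    by (simp add: replicate_append_same)
  then obtain h where h: "h \<in> mhom M (replicate n ast) ast" "Mcomp M bul [h, Idm M ast] = f"
    using weakly_closed_M(3) by blast
  then obtain a where a: "a \<in> mhom M [] ast"
    and "h = Mcomp M (app_pow M ast bul n) (a # replicate n (Idm M ast))"
    using Suc.IH[OF h(1)] by blast
  then have "f = Mcomp M (app_pow M ast bul (Suc n)) (a # replicate (Suc n) (Idm M ast))"
    using app_pow_Suc_arg[OF a] h(2) by metis
  then show ?case
    using a by blast
qed

lemma all_computable:
  assumes "f \<in> Arr M"
  shows "computable M ast bul f"
proof -
  have "f \<in> mhom M (replicate (length (Dom M f)) ast) ast"
    unfolding mhom_def using assms Dom_replicate[OF assms] Cod_ast[OF assms] by blast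
  then show ?thesis
    unfolding computable_def using app_pow_representation by blast
qed

text \<open>Combinatory completeness holds because every morphism of \<open>M\<close>, generated or
  not, is computable.\<close>

sublocale combinatory_complete_system S M ast bul pt
  using generated_Arr all_computable S_arrows
  by unfold_locales (auto simp: combinatory_complete_def)

text \<open>Passing to computable morphisms loses nothing here, which is why the unit is
  invertible.\<close>

lemma Arr_R: "Arr R = Arr M"
  using all_computable computableD(1) by (auto simp: R_simps)

lemma S_triple_L: "S_triple S (L_obj (M, ihom, ev))"
  using combinatory_complete_system_axioms by (simp add: L_obj_def S_triple_iff[OF S_arrows])

lemma S_multifunctor_unit: "S_multifunctor S M R (\<lambda>y\<in>Obj M. pt, \<lambda>f\<in>Arr M. f)"
proof -
  have objs: "map (\<lambda>y\<in>Obj M. pt) As = replicate (length As) pt" "As = replicate (length As) ast"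
    if "set As \<subseteq> Obj M" for As
  proof -
    show eq: "As = replicate (length As) ast"
      using that Obj_M by (intro list_eq_replicate) auto
    show "map (\<lambda>y\<in>Obj M. pt) As = replicate (length As) pt"
      using A_Obj by (subst eq) simp
  qed
  have arrs: "map (\<lambda>f\<in>Arr M. f) gs = gs" if "composable M f gs" for f gs
    using that by (auto simp: composable_def intro!: map_idI)
  have "multifunctor M R (\<lambda>y\<in>Obj M. pt, \<lambda>f\<in>Arr M. f)"
    unfolding multifunctor_def Arr_R
  proof (intro conjI ballI allI impI)
    fix f gs
    show "snd (\<lambda>y\<in>Obj M. pt, \<lambda>f\<in>Arr M. f) (Mcomp M f gs) =
        Mcomp R (snd (\<lambda>y\<in>Obj M. pt, \<lambda>f\<in>Arr M. f) f) (map (snd (\<lambda>y\<in>Obj M. pt, \<lambda>f\<in>Arr M. f)) gs)"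
      if c: "composable M f gs"
      using c Mcomp_Arr(1)[OF c] arrs[OF c] by (simp add: composable_def R_simps)
    show "Dom R (snd (\<lambda>y\<in>Obj M. pt, \<lambda>f\<in>Arr M. f) f) =
        map (fst (\<lambda>y\<in>Obj M. pt, \<lambda>f\<in>Arr M. f)) (Dom M f)" if "f \<in> Arr M"
      using that objs(1)[OF Dom_Obj[OF that]] by (simp add: R_simps)
  qed (use Cod_Obj mhomD(1)[OF Idm_hom] Obj_M in \<open>auto simp: R_simps(1,3-6)\<close>)
  moreover have "(\<lambda>f\<in>Arr M. f) (Act M f a As) = Act R ((\<lambda>f\<in>Arr M. f) f) a (map (\<lambda>y\<in>Obj M. pt) As)"
    if act: "actable S M f a As" for f a As
  proof -
    \<comment> \<open>\<open>Act R\<close> replaces its object list by copies of \<open>ast\<close>,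
      which gives back \<open>As\<close> because \<open>ast\<close> is the only object.\<close>
    have "set As \<subseteq> Obj M" "f \<in> Arr M"
      using act by (auto simp: actable_def)
    then show ?thesis
      using mhomD(1)[OF Act_hom[OF act]] objs(2)[of As] by (simp add: R_simps(7))
  qed
  ultimately show ?thesis
    by (simp add: S_multifunctor_def)
qed

lemma wc_S_multifunctor_unit:
  "wc_S_multifunctor S (M, ihom, ev) (R_obj pt (L_obj (M, ihom, ev)))
    (\<lambda>y\<in>Obj M. pt, \<lambda>f\<in>Arr M. f)"
  using S_multifunctor_unit ihom_ast Obj_M mhomD(1)[OF b_hom]
  by (auto simp: wc_S_multifunctor_def R_obj_def L_obj_def)

text \<open>The inclusion of computable morphisms respects the weakly-closed structure as well: both
  internal homs are the only object, and both evaluations are \<open>bul\<close>. Hence it is a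
  morphism of operads.\<close>

lemma wc_S_multifunctor_unit_inverse:
  "wc_S_multifunctor S (R_obj pt (L_obj (M, ihom, ev))) (M, ihom, ev)
    (\<lambda>y\<in>{pt}. ast, \<lambda>f\<in>Arr R. f)"
  using S_multifunctor_inclusion ihom_ast Obj_M mhomD(1)[OF b_hom] Arr_R
  by (auto simp: wc_S_multifunctor_def R_obj_def L_obj_def R_simps(1))

end

section \<open>The functors on morphisms\<close>

lemma triple_morphism_L:
  assumes "wc_S_operad S X" "wc_S_operad S Y" "S \<subseteq> Fun_arrows" "wc_S_multifunctor S X Y F"
  shows "triple_morphism S (L_obj X) (L_obj Y) F"
proof -
  obtain M i e N i' e' where eq: "X = (M, i, e)" "Y = (N, i', e')"
    by (metis prod_cases3)
  \<comment> \<open>The conclusion does not mention \<open>pt\<close>, so any value serves for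
    it.\<close>
  interpret X: wc_operad S M i e "the_obj M"
    using assms by unfold_locales (simp_all add: eq)
  interpret Y: wc_operad S N i' e' "the_obj N"
    using assms by unfold_locales (simp_all add: eq)
  have "S_multifunctor S M N F"
    using wc_S_multifunctorD[OF assms(4)] by (simp add: eq)
  \<comment> \<open>The distinguished object is preserved because \<open>N\<close> has only one
    object.\<close>
  moreover from this have "fst F (the_obj M) = the_obj N"
    using multifunctor_Obj[OF S_multifunctorD X.A_Obj] Y.Obj_M by blast
  moreover have "snd F (e (the_obj M) (the_obj M)) = e' (fst F (the_obj M)) (fst F (the_obj M))"
    using assms(4) X.A_Obj by (auto simp: wc_S_multifunctor_def eq)
  ultimately show ?thesis
    by (simp add: triple_morphism_def L_obj_def eq)
qed

lemma S_tripleE: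
  assumes "S_triple S X" "S \<subseteq> Fun_arrows"
  obtains M A b where "X = (M, A, b)" "combinatory_complete_system S M A b"
proof -
  obtain M A b where "X = (M, A, b)"
    by (rule prod_cases3)
  then show thesis
    using that assms(1) by (simp add: S_triple_iff[OF assms(2)])
qed

lemma wc_S_multifunctor_R:
  assumes "S_triple S X" "S_triple S Y" "S \<subseteq> Fun_arrows" "triple_morphism S X Y F"
  shows "wc_S_multifunctor S (R_obj pt X) (R_obj pt Y)
    (\<lambda>x\<in>{pt}. pt, \<lambda>f\<in>Arr (R_multicat pt X). snd F f)"
proof -
  obtain M A b where X: "X = (M, A, b)" "combinatory_complete_system S M A b"
    using assms(1,3) by (rule S_tripleE)
  obtain N B c where Y: "Y = (N, B, c)" "combinatory_complete_system S N B c"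
    using assms(2,3) by (rule S_tripleE)
  interpret X: combinatory_complete_system S M A b pt by fact
  interpret Y: combinatory_complete_system S N B c pt by fact
  interpret RX: S_multicategory S X.R by (rule X.S_multicategory_R)
  have F: "S_multifunctor S M N F" "fst F A = B" "snd F b = c"
    using assms(4) by (auto simp: triple_morphism_def X(1) Y(1))
  note mF = S_multifunctorD[OF F(1)]
  have arr: "snd F f \<in> Arr Y.R" if "f \<in> Arr X.R" for f
    using multifunctor_computable[OF X.applicative_multicategory_axioms mF] that F
    by (simp add: X.R_simps Y.R_simps)
  let ?G = "(\<lambda>x\<in>{pt}. pt, \<lambda>f\<in>Arr X.R. snd F f)"
  have "multifunctor X.R Y.R ?G"
    unfolding multifunctor_def
  proof (intro conjI ballI allI impI)
    show "fst ?G \<in> Obj X.R \<rightarrow>\<^sub>E Obj Y.R" "snd ?G \<in> Arr X.R \<rightarrow>\<^sub>E Arr Y.R"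
      using arr by (auto simp: X.R_simps(1) Y.R_simps(1))
    show "Dom Y.R (snd ?G f) = map (fst ?G) (Dom X.R f)" "Cod Y.R (snd ?G f) = fst ?G (Cod X.R f)"
      if "f \<in> Arr X.R" for f
      using that multifunctor_Dom[OF mF X.R_Arr_M[OF that]]
      by (simp_all add: X.R_simps(3,4) Y.R_simps(3,4))
    show "snd ?G (Idm X.R x) = Idm Y.R (fst ?G x)" if "x \<in> Obj X.R" for x
      using mhomD(1)[OF RX.Idm_hom[OF that]] multifunctor_Idm[OF mF X.A_Obj] F(2)
      by (simp add: X.R_simps(5) Y.R_simps(5))
    show "snd ?G (Mcomp X.R f gs) = Mcomp Y.R (snd ?G f) (map (snd ?G) gs)"
      if c: "composable X.R f gs" for f gs
    proof -
      \<comment> \<open>All entries of \<open>gs\<close> are computable, so the restriction in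
        \<open>?G\<close> is invisible on them.\<close>
      have "f \<in> Arr X.R" and map_G: "map (snd ?G) gs = map (snd F) gs"
        using c by (auto simp: composable_def)
      then show ?thesis
        unfolding map_G
        using RX.Mcomp_Arr(1)[OF c] multifunctor_Mcomp[OF mF X.composable_R[OF c]]
        by (simp add: X.R_simps(6) Y.R_simps(6))
    qed
  qed
  moreover have "snd ?G (Act X.R f a xs) = Act Y.R (snd ?G f) a (map (fst ?G) xs)"
    if act: "actable S X.R f a xs" for f a xs
  proof -
    have "snd F (Act M f a (replicate (length xs) A)) =
        Act N (snd F f) a (map (fst F) (replicate (length xs) A))"
      using F(1) X.actable_R(1)[OF act] unfolding S_multifunctor_def by blast
    moreover have "f \<in> Arr X.R"
      using act by (simp add: actable_def)
    ultimately show ?thesis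
      using mhomD(1)[OF RX.Act_hom[OF act]] F(2) by (simp add: X.R_simps(7) Y.R_simps(7))
  qed
  ultimately have "S_multifunctor S X.R Y.R ?G"
    by (simp add: S_multifunctor_def)
  \<comment> \<open>The restricted map has to be evaluated at \<open>b\<close>, the evaluation
    morphism of the operad.\<close>
  moreover have "b \<in> Arr X.R"
    using X.generated_b by (simp add: X.R_simps X.computable_iff)
  ultimately show ?thesis
    using F(3) by (simp add: wc_S_multifunctor_def R_obj_def X(1) Y(1) X.R_simps(1))
qed

section \<open>Unit and counit\<close>

definition unit_mfun :: "'o \<Rightarrow> ('o, 'm) wc_smulticat \<Rightarrow> ('o, 'm, 'o, 'm) mfun" where
  "unit_mfun pt X = (\<lambda>y\<in>Obj (fst X). pt, \<lambda>f\<in>Arr (fst X). f)"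

text \<open>\<open>fst (snd Y)\<close> is the distinguished object of the triple \<open>Y\<close>,
  the image of \<open>*\<close>.\<close>

definition counit_mfun :: "'o \<Rightarrow> ('o, 'm) triple \<Rightarrow> ('o, 'm, 'o, 'm) mfun" where
  "counit_mfun pt Y = (\<lambda>y\<in>{pt}. fst (snd Y), \<lambda>f\<in>Arr (R_multicat pt Y). f)"

lemma wc_S_operad_R_obj: "S_triple S X \<Longrightarrow> S \<subseteq> Fun_arrows \<Longrightarrow> wc_S_operad S (R_obj pt X)"
  by (erule S_tripleE) (auto intro: combinatory_complete_system.wc_S_operad_R)

lemma S_triple_L_obj: "wc_S_operad S X \<Longrightarrow> S \<subseteq> Fun_arrows \<Longrightarrow> S_triple S (L_obj X)"
  by (cases X rule: prod_cases3) (auto intro: wc_operad.S_triple_L wc_operad.intro)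

lemma fst_L_obj: "fst (L_obj X) = fst X"
  by (simp add: L_obj_def split: prod.split)

lemma fst_R_obj: "fst (R_obj pt Y) = R_multicat pt Y"
  by (simp add: R_obj_def split: prod.split)

lemma Obj_R_multicat: "Obj (R_multicat pt Y) = {pt}"
  by (simp add: R_multicat_def split: prod.split)

lemma Arr_R_multicat_L_obj:
  assumes "wc_S_operad S X" "S \<subseteq> Fun_arrows"
  shows "Arr (R_multicat pt (L_obj X)) = Arr (fst X)"
proof -
  obtain M i e where eq: "X = (M, i, e)"
    by (rule prod_cases3)
  interpret wc_operad S M i e pt
    using assms by unfold_locales (simp_all add: eq)
  show ?thesis
    using Arr_R by (simp add: eq L_obj_def)
qed

lemma wc_S_multifunctor_unit_mfun:
  assumes "wc_S_operad S X" "S \<subseteq> Fun_arrows"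
  shows "wc_S_multifunctor S X (R_obj pt (L_obj X)) (unit_mfun pt X)"
proof -
  obtain M i e where eq: "X = (M, i, e)"
    by (rule prod_cases3)
  interpret wc_operad S M i e pt
    using assms by unfold_locales (simp_all add: eq)
  show ?thesis
    using wc_S_multifunctor_unit by (simp add: eq unit_mfun_def)
qed

lemma wc_S_multifunctor_counit_L:
  assumes "wc_S_operad S X" "S \<subseteq> Fun_arrows"
  shows "wc_S_multifunctor S (R_obj pt (L_obj X)) X (counit_mfun pt (L_obj X))"
proof -
  obtain M i e where eq: "X = (M, i, e)"
    by (rule prod_cases3)
  interpret wc_operad S M i e pt
    using assms by unfold_locales (simp_all add: eq)
  show ?thesis
    using wc_S_multifunctor_unit_inverse by (simp add: eq counit_mfun_def L_obj_def)
qed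

lemma triple_morphism_counit:
  assumes "S_triple S Y" "S \<subseteq> Fun_arrows"
  shows "triple_morphism S (L_obj (R_obj pt Y)) Y (counit_mfun pt Y)"
proof -
  obtain M A b where eq: "Y = (M, A, b)" "combinatory_complete_system S M A b"
    using assms by (rule S_tripleE)
  interpret combinatory_complete_system S M A b pt by fact
  have "the_obj R = pt" "b \<in> Arr R"
    using generated_b by (simp_all add: the_obj_def R_simps computable_iff)
  then show ?thesis
    using S_multifunctor_inclusion
    by (simp add: triple_morphism_def L_obj_def R_obj_def eq(1) counit_mfun_def)
qed

text \<open>Both maps are the identity on morphisms, and on objects only one value is possible. As
  \<open>L\<close> keeps morphisms unchanged, this serves both as a triangle identity and as one
  half of the invertibility of the unit.\<close>

lemma counit_unit:
  assumes "wc_S_operad S X" "S \<subseteq> Fun_arrows"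
  shows "mfun_comp (fst X) (counit_mfun pt (L_obj X)) (unit_mfun pt X) = mfun_id (fst X)"
proof -
  obtain M i e where eq: "X = (M, i, e)"
    by (rule prod_cases3)
  interpret wc_operad S M i e pt
    using assms by unfold_locales (simp_all add: eq)
  show ?thesis
    using Obj_M Arr_R_multicat_L_obj[OF assms, of pt]
    by (auto simp: mfun_comp_def counit_mfun_def unit_mfun_def mfun_id_def compose_def eq L_obj_def
        fun_eq_iff)
qed

lemma unit_counit:
  assumes "wc_S_operad S X" "S \<subseteq> Fun_arrows"
  shows "mfun_comp (R_multicat pt (L_obj X)) (unit_mfun pt X) (counit_mfun pt (L_obj X)) =
    mfun_id (R_multicat pt (L_obj X))"
proof -
  obtain M i e where eq: "X = (M, i, e)"
    by (rule prod_cases3)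
  interpret wc_operad S M i e pt
    using assms by unfold_locales (simp_all add: eq)
  show ?thesis
    using Obj_M Arr_R_multicat_L_obj[OF assms, of pt]
    by (auto simp: mfun_comp_def counit_mfun_def unit_mfun_def mfun_id_def compose_def eq L_obj_def
        fun_eq_iff Obj_R_multicat)
qed

section \<open>Functoriality and naturality\<close>

lemma cat_functor_L:
  assumes "S \<subseteq> Fun_arrows"
  shows "cat_functor (O_cat S :: (('o, 'm) wc_smulticat, ('o, 'm, 'o, 'm) mfun) cat)
    (T_cat S) L_fun"
  by (intro cat_functor.intro category_O_cat category_T_cat cat_functor_axioms.intro assms)
    (auto simp: O_cat_def T_cat_def L_fun_def fst_L_obj S_triple_L_obj triple_morphism_L assms)

text \<open>Needed wherever a map restricted to computable morphisms is evaluated at an image under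
  \<open>F\<close>, as in the functoriality of \<open>R\<close> and the naturality of the
  counit.\<close>

lemma triple_morphism_Arr_R_multicat:
  assumes "S_triple S X" "triple_morphism S X Y F" "S \<subseteq> Fun_arrows"
    "f \<in> Arr (R_multicat pt X)"
  shows "snd F f \<in> Arr (R_multicat pt Y)"
proof -
  obtain M A b where X: "X = (M, A, b)" "combinatory_complete_system S M A b"
    using assms(1,3) by (rule S_tripleE)
  interpret X: combinatory_complete_system S M A b pt by fact
  obtain N B c where Y: "Y = (N, B, c)"
    by (rule prod_cases3)
  have "multifunctor M N F" "fst F A = B" "snd F b = c"
    using assms(2) by (auto simp: triple_morphism_def X(1) Y S_multifunctor_def)
  then show ?thesis
    using multifunctor_computable[OF X.applicative_multicategory_axioms, of N F f] assms(4)
    by (simp add: R_multicat_def X(1) Y)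
qed

lemma Arr_R_multicat_subset:
  assumes "S_triple S X" "S \<subseteq> Fun_arrows" "f \<in> Arr (R_multicat pt X)"
  shows "f \<in> Arr (fst X)"
proof -
  obtain M A b where X: "X = (M, A, b)" "combinatory_complete_system S M A b"
    using assms(1,2) by (rule S_tripleE)
  interpret X: combinatory_complete_system S M A b pt by fact
  show ?thesis
    using X.R_Arr_M assms(3) by (simp add: X(1))
qed

lemma cat_functor_R:
  assumes "S \<subseteq> Fun_arrows"
  shows "cat_functor (T_cat S :: (('o, 'm) triple, ('o, 'm, 'o, 'm) mfun) cat)
    (O_cat S) (R_fun pt)"
proof (intro cat_functor.intro category_O_cat category_T_cat cat_functor_axioms.intro assms)
  fix X Y Z :: "('o, 'm) triple" and F G :: "('o, 'm, 'o, 'm) mfun"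
  assume X: "X \<in> Ob (T_cat S)"
  then have tX: "S_triple S X"
    by (simp add: T_cat_def)
  note arr = Arr_R_multicat_subset[OF tX assms]
  show "FOb (R_fun pt) X \<in> Ob (O_cat S)"
    using tX by (simp add: O_cat_def R_fun_def wc_S_operad_R_obj assms)
  show "FAr (R_fun pt) X X (CId (T_cat S) X) = CId (O_cat S) (FOb (R_fun pt) X)"
    using arr by (auto simp: O_cat_def T_cat_def R_fun_def mfun_id_def fst_R_obj Obj_R_multicat
        fun_eq_iff)
  assume Y: "Y \<in> Ob (T_cat S)" and F: "F \<in> Hom (T_cat S) X Y"
  then show "FAr (R_fun pt) X Y F \<in> Hom (O_cat S) (FOb (R_fun pt) X) (FOb (R_fun pt) Y)"
    using tX by (simp add: O_cat_def T_cat_def R_fun_def wc_S_multifunctor_R assms)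
  have "triple_morphism S X Y F"
    using F by (simp add: T_cat_def)
  \<comment> \<open>Since \<open>F\<close> sends computable morphisms to computable ones, the
    restriction of a composite is the composite of the restrictions.\<close>
  from triple_morphism_Arr_R_multicat[OF tX this assms]
  show "FAr (R_fun pt) X Z (CComp (T_cat S) X Y Z G F) =
      CComp (O_cat S) (FOb (R_fun pt) X) (FOb (R_fun pt) Y) (FOb (R_fun pt) Z)
        (FAr (R_fun pt) Y Z G) (FAr (R_fun pt) X Y F)"
    using arr by (auto simp: O_cat_def T_cat_def R_fun_def mfun_comp_def compose_def fst_R_obj
        Obj_R_multicat fun_eq_iff)
qed

text \<open>Both composites act as \<open>F\<close> on morphisms and send every object to
  \<open>pt\<close>.\<close>

lemma natural_unit:
  assumes "S \<subseteq> Fun_arrows"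
  shows "natural_transformation (O_cat S :: (('o, 'm) wc_smulticat, ('o, 'm, 'o, 'm) mfun) cat)
    (O_cat S) cfun_id (cfun_comp (R_fun pt) L_fun) (unit_mfun pt)"
  unfolding natural_transformation_def
proof (intro conjI ballI)
  fix X Y :: "('o, 'm) wc_smulticat" and F
  assume "X \<in> Ob (O_cat S)"
  then have X: "wc_S_operad S X"
    by (simp add: O_cat_def)
  show "unit_mfun pt X \<in> Hom (O_cat S) (FOb cfun_id X) (FOb (cfun_comp (R_fun pt) L_fun) X)"
    using wc_S_multifunctor_unit_mfun[OF X assms]
    by (simp add: O_cat_def cfun_id_def cfun_comp_def R_fun_def L_fun_def)
  assume "F \<in> Hom (O_cat S) X Y"
  then have "multifunctor (fst X) (fst Y) F"
    by (simp add: O_cat_def S_multifunctorD[OF wc_S_multifunctorD])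
  note F = multifunctor_Obj[OF this] multifunctor_Arr[OF this]
  show "CComp (O_cat S) (FOb cfun_id X) (FOb cfun_id Y) (FOb (cfun_comp (R_fun pt) L_fun) Y)
      (unit_mfun pt Y) (FAr cfun_id X Y F) =
    CComp (O_cat S) (FOb cfun_id X) (FOb (cfun_comp (R_fun pt) L_fun) X)
      (FOb (cfun_comp (R_fun pt) L_fun) Y) (FAr (cfun_comp (R_fun pt) L_fun) X Y F)
      (unit_mfun pt X)"
    using F Arr_R_multicat_L_obj[OF X assms, of pt]
    by (auto simp: O_cat_def cfun_id_def cfun_comp_def R_fun_def L_fun_def unit_mfun_def
        mfun_comp_def compose_def fun_eq_iff)
qed

text \<open>Both composites act as \<open>F\<close> on computable morphisms; on the object
  \<open>pt\<close> the square says that \<open>F\<close> preserves the distinguished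
  object.\<close>

lemma natural_counit:
  assumes "S \<subseteq> Fun_arrows"
  shows "natural_transformation (T_cat S :: (('o, 'm) triple, ('o, 'm, 'o, 'm) mfun) cat)
    (T_cat S) (cfun_comp L_fun (R_fun pt)) cfun_id (counit_mfun pt)"
  unfolding natural_transformation_def
proof (intro conjI ballI)
  fix X Y :: "('o, 'm) triple" and F
  assume "X \<in> Ob (T_cat S)"
  then have X: "S_triple S X"
    by (simp add: T_cat_def)
  show "counit_mfun pt X \<in> Hom (T_cat S) (FOb (cfun_comp L_fun (R_fun pt)) X) (FOb cfun_id X)"
    using triple_morphism_counit[OF X assms]
    by (simp add: T_cat_def cfun_id_def cfun_comp_def R_fun_def L_fun_def)
  assume "F \<in> Hom (T_cat S) X Y"
  then have F: "triple_morphism S X Y F"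
    by (simp add: T_cat_def)
  then have "fst F (fst (snd X)) = fst (snd Y)"
    by (auto simp: triple_morphism_def split: prod.splits)
  then show "CComp (T_cat S) (FOb (cfun_comp L_fun (R_fun pt)) X)
      (FOb (cfun_comp L_fun (R_fun pt)) Y) (FOb cfun_id Y)
      (counit_mfun pt Y) (FAr (cfun_comp L_fun (R_fun pt)) X Y F) =
    CComp (T_cat S) (FOb (cfun_comp L_fun (R_fun pt)) X) (FOb cfun_id X) (FOb cfun_id Y)
      (FAr cfun_id X Y F) (counit_mfun pt X)"
    using triple_morphism_Arr_R_multicat[OF X F assms, of _ pt]
    by (auto simp: T_cat_def cfun_id_def cfun_comp_def R_fun_def L_fun_def counit_mfun_def
        mfun_comp_def compose_def fst_L_obj fst_R_obj Obj_R_multicat fun_eq_iff)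
qed

section \<open>Triangle identities and invertibility of the unit\<close>

lemma R_counit_unit:
  assumes Y: "S_triple S Y" and S: "S \<subseteq> Fun_arrows"
  shows "mfun_comp (R_multicat pt Y) (FAr (R_fun pt) (L_obj (R_obj pt Y)) Y (counit_mfun pt Y))
    (unit_mfun pt (R_obj pt Y)) = mfun_id (R_multicat pt Y)"
proof -
  \<comment> \<open>\<open>R Y\<close> is itself a weakly-closed operad, so all its morphisms are
    computable in it and the restriction inside \<open>R\<close> of the counit removes none of
    them.\<close>
  have "Arr (R_multicat pt (L_obj (R_obj pt Y))) = Arr (R_multicat pt Y)"
    using Arr_R_multicat_L_obj[OF wc_S_operad_R_obj[OF Y S] S] by (simp add: fst_R_obj)
  then show ?thesis
    by (auto simp: mfun_comp_def R_fun_def counit_mfun_def unit_mfun_def mfun_id_def compose_def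
        fst_R_obj Obj_R_multicat fun_eq_iff)
qed

lemma adjunction_L_R:
  assumes S: "S \<subseteq> Fun_arrows"
  shows "adjunction
    (O_cat S :: (('o, 'm) wc_smulticat, ('o, 'm, 'o, 'm) mfun) cat)
    (T_cat S :: (('o, 'm) triple, ('o, 'm, 'o, 'm) mfun) cat)
    L_fun (R_fun pt) (unit_mfun pt) (counit_mfun pt)"
  unfolding adjunction_def
proof (intro conjI ballI cat_functor_L cat_functor_R natural_unit natural_counit S)
  fix X :: "('o, 'm) wc_smulticat"
  assume "X \<in> Ob (O_cat S)"
  then show "CComp (T_cat S) (FOb L_fun X) (FOb L_fun (FOb (R_fun pt) (FOb L_fun X))) (FOb L_fun X)
      (counit_mfun pt (FOb L_fun X)) (FAr L_fun X (FOb (R_fun pt) (FOb L_fun X)) (unit_mfun pt X)) =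
    CId (T_cat S) (FOb L_fun X)"
    using counit_unit[OF _ S, of X pt] by (simp add: O_cat_def T_cat_def L_fun_def fst_L_obj)
next
  fix Y :: "('o, 'm) triple"
  assume "Y \<in> Ob (T_cat S)"
  then show "CComp (O_cat S) (FOb (R_fun pt) Y) (FOb (R_fun pt) (FOb L_fun (FOb (R_fun pt) Y)))
      (FOb (R_fun pt) Y) (FAr (R_fun pt) (FOb L_fun (FOb (R_fun pt) Y)) Y (counit_mfun pt Y))
      (unit_mfun pt (FOb (R_fun pt) Y)) =
    CId (O_cat S) (FOb (R_fun pt) Y)"
    using R_counit_unit[OF _ S, of Y pt]
    by (simp add: O_cat_def T_cat_def L_fun_def R_fun_def fst_R_obj)
qed

lemma isomorphism_unit:
  assumes "wc_S_operad S X" "S \<subseteq> Fun_arrows"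
  shows "isomorphism (O_cat S) X (FOb (R_fun pt) (FOb L_fun X)) (unit_mfun pt X)"
  unfolding isomorphism_def
\<comment> \<open>The inverse of the unit at \<open>X\<close> is the counit at \<open>L X\<close>,
  which is also a morphism of operads.\<close>
proof (intro conjI bexI[of _ "counit_mfun pt (L_obj X)"])
  show "unit_mfun pt X \<in> Hom (O_cat S) X (FOb (R_fun pt) (FOb L_fun X))"
    by (simp add: O_cat_def R_fun_def L_fun_def wc_S_multifunctor_unit_mfun assms)
  show "counit_mfun pt (L_obj X) \<in> Hom (O_cat S) (FOb (R_fun pt) (FOb L_fun X)) X"
    by (simp add: O_cat_def R_fun_def L_fun_def wc_S_multifunctor_counit_L assms)
qed (simp_all add: O_cat_def R_fun_def L_fun_def fst_R_obj counit_unit[OF assms] unit_counit[OF assms])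

theorem theorem6p12:
  fixes S :: "fin_fun set" and pt :: 'o
  assumes "faithful_cartesian_club S"
  shows "\<exists>\<eta> \<epsilon>.
    adjunction
      (O_cat S :: (('o, 'm) wc_smulticat, ('o, 'm, 'o, 'm) mfun) cat)
      (T_cat S :: (('o, 'm) triple, ('o, 'm, 'o, 'm) mfun) cat)
      L_fun (R_fun pt) \<eta> \<epsilon> \<and>
    (\<forall>X \<in> Ob (O_cat S :: (('o, 'm) wc_smulticat, ('o, 'm, 'o, 'm) mfun) cat).
      isomorphism (O_cat S) X (FOb (R_fun pt) (FOb L_fun X)) (\<eta> X))"
proof (intro exI conjI ballI)
  have S: "S \<subseteq> Fun_arrows"
    using assms by (rule faithful_cartesian_club.arrows)
  show "adjunction
      (O_cat S :: (('o, 'm) wc_smulticat, ('o, 'm, 'o, 'm) mfun) cat)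
      (T_cat S :: (('o, 'm) triple, ('o, 'm, 'o, 'm) mfun) cat)
      L_fun (R_fun pt) (unit_mfun pt) (counit_mfun pt)"
    by (rule adjunction_L_R[OF S])
  fix X :: "('o, 'm) wc_smulticat"
  assume "X \<in> Ob (O_cat S)"
  then show "isomorphism (O_cat S) X (FOb (R_fun pt) (FOb L_fun X)) (unit_mfun pt X)"
    by (intro isomorphism_unit S) (simp add: O_cat_def)
qed

end
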